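(* Let $t\geq 1$ and $h\geq 0$ be integers. Every graph $G$ with treewidth $t-1$ has pathwidth at most $th+1$ or contains (as a subgraph) a subdivision of a complete binary tree of height $h+1$.
   Context: Graphs are finite, simple and undirected. A tree decomposition of $G$ is a pair $(T,\{B_x\}_{x\in V(T)})$ with $T$ a tree and $B_x\subseteq V(G)$ such that for every vertex $v$ the nodes $x$ with $v\in B_x$ induce a non-empty subtree of $T$, and every edge of $G$ has both endpoints in some bag; its width is $\max_x|B_x|-1$. Treewidth is the minimum width of a tree decomposition; path decompositions and pathwidth are defined analogously with $T$ required to be a path. A complete binary tree of height $h$ is a rooted tree in which every non-leaf node has two children and every root-to-leaf path has $h$ edges. A subdivision of a tree is obtained by replacing each edge $uv$ by a path from $u$ to $v$ whose internal vertices are new and private to that path. *)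

theory Defs
  imports "Graph_Theory.Graph_Theory"
begin

text \<open>
  Finite simple undirected graphs are symmetric loop-free finite digraphs without parallel arcs:
  the locales \<^locale>\<open>pair_graph\<close> and \<^locale>\<open>graph\<close>. The library's \<^const>\<open>tree\<close> is
  unsuitable for them: its cycles may have length 2, so a symmetric digraph with an edge is never
  a \<^const>\<open>forest\<close>. In an undirected graph a cycle has length at least 3.
\<close>

definition undirected_tree :: "('a, 'b) pre_digraph \<Rightarrow> bool" where
  "undirected_tree T \<longleftrightarrow>
     graph T \<and> connected T \<and> \<not> (\<exists>p. pre_digraph.cycle T p \<and> length p \<ge> 3)"

definition path_graph :: "'a pair_pre_digraph \<Rightarrow> bool" where
  "path_graph P \<longleftrightarrow>
     (\<exists>xs. xs \<noteq> [] \<and> distinct xs \<and> pverts P = set xs \<and>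
           parcs P = set (vwalk_arcs xs) \<union> (set (vwalk_arcs xs))\<inverse>)"

text \<open>
  Only the values of \<open>B\<close> on the nodes of \<open>T\<close> matter. That the nodes whose bags contain \<open>v\<close> induce
  a non-empty subtree is expressed by the induced subgraph being a tree, since
  \<^const>\<open>connected\<close> graphs are non-empty.
\<close>

definition tree_decomposition ::
  "'a pair_pre_digraph \<Rightarrow> 'n pair_pre_digraph \<Rightarrow> ('n \<Rightarrow> 'a set) \<Rightarrow> bool" where
  "tree_decomposition G T B \<longleftrightarrow>
     undirected_tree (with_proj T) \<and>
     (\<forall>x \<in> pverts T. B x \<subseteq> pverts G) \<and>
     (\<forall>v \<in> pverts G. undirected_tree (with_proj T \<restriction> {x \<in> pverts T. v \<in> B x})) \<and>
     (\<forall>(u, v) \<in> parcs G. \<exists>x \<in> pverts T. u \<in> B x \<and> v \<in> B x)"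

definition path_decomposition ::
  "'a pair_pre_digraph \<Rightarrow> 'n pair_pre_digraph \<Rightarrow> ('n \<Rightarrow> 'a set) \<Rightarrow> bool" where
  "path_decomposition G P B \<longleftrightarrow> path_graph P \<and> tree_decomposition G P B"

text \<open>Widths are integers, so that the graph without vertices has treewidth and pathwidth \<open>-1\<close>.\<close>

definition decomposition_width :: "'n pair_pre_digraph \<Rightarrow> ('n \<Rightarrow> 'a set) \<Rightarrow> int" where
  "decomposition_width T B = int (Max ((\<lambda>x. card (B x)) ` pverts T)) - 1"

text \<open>
  Every finite tree is isomorphic to one whose nodes are natural numbers, so taking the minimum
  over decompositions with nodes in \<^typ>\<open>nat\<close> is no restriction.
\<close>

definition treewidth :: "'a pair_pre_digraph \<Rightarrow> int" where
  "treewidth G = (LEAST w. \<exists>(T :: nat pair_pre_digraph) B.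
     tree_decomposition G T B \<and> w = decomposition_width T B)"

definition pathwidth :: "'a pair_pre_digraph \<Rightarrow> int" where
  "pathwidth G = (LEAST w. \<exists>(P :: nat pair_pre_digraph) B.
     path_decomposition G P B \<and> w = decomposition_width P B)"

text \<open>
  In a tree rooted at \<open>r\<close>, the node \<open>y\<close> is a child of \<open>x\<close> iff the path from \<open>r\<close> to \<open>y\<close> ends with
  the edge \<open>xy\<close>.
\<close>

definition children :: "'a pair_pre_digraph \<Rightarrow> 'a \<Rightarrow> 'a \<Rightarrow> 'a set" where
  "children T r x = {y. \<exists>p. pre_digraph.apath (with_proj T) r (p @ [(x, y)]) y}"

definition complete_binary_tree :: "nat \<Rightarrow> 'a pair_pre_digraph \<Rightarrow> bool" where
  "complete_binary_tree h T \<longleftrightarrow>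
     undirected_tree (with_proj T) \<and>
     (\<exists>r \<in> pverts T.
        (\<forall>x \<in> pverts T. children T r x \<noteq> {} \<longrightarrow> card (children T r x) = 2) \<and>
        (\<forall>x p. pre_digraph.apath (with_proj T) r p x \<and> children T r x = {} \<longrightarrow> length p = h))"

text \<open>
  \<^term>\<open>subdivision_pair T H\<close> says that \<open>H\<close> arises from \<open>T\<close> by repeatedly replacing an edge by a
  path of length 2 through a new vertex, i.e. by replacing each edge by a path whose internal
  vertices are new and private to it.
\<close>

definition contains_subdivided_binary_tree :: "nat \<Rightarrow> 'a pair_pre_digraph \<Rightarrow> bool" where
  "contains_subdivided_binary_tree h G \<longleftrightarrow>
     (\<exists>T H. complete_binary_tree h T \<and> subdivision_pair T H \<and>
            subgraph (with_proj H) (with_proj G))"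


text \<open>The minima defining treewidth and pathwidth are attained.\<close>

lemma undirected_tree_singleton:
  assumes "verts T = {x}" "arcs T = {}"
  shows "undirected_tree T"
proof -
  have "graph T"
    using assms by unfold_locales (auto simp: symmetric_conv)
  moreover have "connected T"
    using assms by (auto simp: connected_def strongly_connected_def mk_symmetric_def
        reachable_def intro: rtrancl_on.intros)
  moreover have "\<not> (\<exists>p. pre_digraph.cycle T p \<and> length p \<ge> 3)"
    using assms by (auto simp: pre_digraph.cycle_def pre_digraph.awalk_def)
  ultimately show ?thesis
    by (simp add: undirected_tree_def)
qed

lemma path_decomposition_trivial:
  assumes "pair_graph G"
  shows "path_decomposition G \<lparr>pverts = {0::nat}, parcs = {}\<rparr> (\<lambda>_. pverts G)"
proof -
  interpret pair_graph G by fact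
  have "path_graph \<lparr>pverts = {0::nat}, parcs = {}\<rparr>"
    unfolding path_graph_def by (intro exI[of _ "[0]"]) simp
  then show ?thesis
    unfolding path_decomposition_def tree_decomposition_def
    by (auto intro!: undirected_tree_singleton dest: in_arcsD1 in_arcsD2)
qed

lemma int_LeastI_bounded:
  fixes w :: int
  assumes "P w" "\<And>w. P w \<Longrightarrow> m \<le> w"
  shows "P (LEAST w. P w)" and "\<And>w. P w \<Longrightarrow> (LEAST w. P w) \<le> w"
proof -
  define n where "n = (LEAST n::nat. P (m + int n))"
  have ex: "P (m + int (nat (w - m)))"
    using assms by simp
  have n: "P (m + int n)"
    unfolding n_def by (rule LeastI[where P = "\<lambda>n. P (m + int n)", OF ex])
  have least: "m + int n \<le> w'" if "P w'" for w'
  proof -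
    have "P (m + int (nat (w' - m)))"
      using that assms(2) by simp
    then have "n \<le> nat (w' - m)"
      unfolding n_def by (rule Least_le)
    then show ?thesis
      using assms(2)[OF that] by linarith
  qed
  have eq: "(LEAST w. P w) = m + int n"
    using n least by (rule Least_equality)
  show "P (LEAST w. P w)"
    using n eq by simp
  show "\<And>w. P w \<Longrightarrow> (LEAST w. P w) \<le> w"
    using least eq by simp
qed

lemma decomposition_width_ge: "- 1 \<le> decomposition_width T B"
  by (simp add: decomposition_width_def)

lemma treewidth_attained:
  assumes "pair_graph G"
  shows "\<exists>(T :: nat pair_pre_digraph) B.
           tree_decomposition G T B \<and> treewidth G = decomposition_width T B"
  unfolding treewidth_def
  by (rule int_LeastI_bounded(1)[where m = "- 1"])
     (use path_decomposition_trivial[OF assms] decomposition_width_ge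
      in \<open>auto simp: path_decomposition_def\<close>)

lemma treewidth_le:
  fixes T :: "nat pair_pre_digraph"
  assumes "tree_decomposition G T B"
  shows "treewidth G \<le> decomposition_width T B"
  unfolding treewidth_def
  by (rule int_LeastI_bounded(2)[where m = "- 1"]) (use assms decomposition_width_ge in auto)

lemma pathwidth_attained:
  assumes "pair_graph G"
  shows "\<exists>(P :: nat pair_pre_digraph) B.
           path_decomposition G P B \<and> pathwidth G = decomposition_width P B"
  unfolding pathwidth_def
  by (rule int_LeastI_bounded(1)[where m = "- 1"])
     (use path_decomposition_trivial[OF assms] decomposition_width_ge in auto)

lemma pathwidth_le:
  fixes P :: "nat pair_pre_digraph"
  assumes "path_decomposition G P B"
  shows "pathwidth G \<le> decomposition_width P B"
  unfolding pathwidth_def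
  by (rule int_LeastI_bounded(2)[where m = "- 1"]) (use assms decomposition_width_ge in auto)

end

theory Submission
  imports Defs
begin

text \<open>
  Call every connected set heavy of order \<open>0\<close>, and call a connected set \<open>A\<close> heavy of order \<open>h + 1\<close>
  if it contains three disjoint sets that are heavy of order \<open>h\<close> and whose removal leaves \<open>A\<close>
  connected. A set that is heavy of order \<open>h\<close> contains a subdivided complete binary tree of
  height \<open>h\<close>, with a stem that starts at any prescribed vertex \<open>r\<close>: two of the three parts avoid
  \<open>r\<close>, and both are reached from \<open>r\<close> by a connected set disjoint from them.

  Now let \<open>A\<close> be connected but not heavy of order \<open>h + 1\<close>. A side of \<open>A\<close> is a connected proper
  subset with connected complement whose neighbourhood lies in a bag of the given tree decomposition.
  Every side \<open>C\<close> has a separator \<open>Z\<close> inside a bag that contains the neighbourhood of \<open>C\<close>, meets \<open>C\<close>,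
  and such that the components of \<open>C - Z\<close> are again sides. Start with a minimal heavy side \<open>C0\<close> of
  order \<open>h\<close>. As \<open>A\<close> is not heavy of order \<open>h + 1\<close>, at most one of the components left by each
  separator outside \<open>C0\<close> is heavy of order \<open>h\<close>, and it is the one to enter next. The separators met
  on this walk form a path decomposition once every other component \<open>D\<close> is inserted at its
  separator: by induction \<open>D\<close> has a path decomposition with bags of size at most \<open>t (h - 1) + 2\<close>, and
  adding the separator to its bags gives the size \<open>t h + 2\<close>. For \<open>h = 0\<close> no light components exist,
  and the separators can be taken to have two elements.
\<close>

section \<open>Connected sets and components\<close>

locale symmetric_relation =
  fixes E :: "'a \<Rightarrow> 'a \<Rightarrow> bool"
  assumes sym: "E u v \<Longrightarrow> E v u"
begin

text \<open>Connectivity is expressed by closed subsets instead of walks. A connected set is then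
  exploited by exhibiting a subset that adjacency does not leave.\<close>

definition conn :: "'a set \<Rightarrow> bool" where
  "conn A \<longleftrightarrow> A \<noteq> {} \<and>
     (\<forall>X. X \<subseteq> A \<longrightarrow> X \<noteq> {} \<longrightarrow> (\<forall>u \<in> X. \<forall>v \<in> A. E u v \<longrightarrow> v \<in> X) \<longrightarrow> X = A)"

text \<open>The component of \<open>a\<close> in \<open>A\<close>, provided that \<open>a \<in> A\<close>: the set contains \<open>a\<close> in any case.\<close>

inductive_set comp :: "'a set \<Rightarrow> 'a \<Rightarrow> 'a set" for A a where
  base: "a \<in> comp A a"
| step: "u \<in> comp A a \<Longrightarrow> v \<in> A \<Longrightarrow> E u v \<Longrightarrow> v \<in> comp A a"

definition comps :: "'a set \<Rightarrow> 'a set set" where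
  "comps A = comp A ` A"

definition nb :: "'a set \<Rightarrow> 'a set \<Rightarrow> 'a set" where
  "nb A C = {v \<in> A - C. \<exists>u \<in> C. E u v}"

lemma conn_nonempty: "conn A \<Longrightarrow> A \<noteq> {}"
  by (simp add: conn_def)

lemma conn_closed_eq:
  assumes "conn A" "X \<subseteq> A" "x \<in> X" "\<And>u v. u \<in> X \<Longrightarrow> v \<in> A \<Longrightarrow> E u v \<Longrightarrow> v \<in> X"
  shows "X = A"
  using assms unfolding conn_def by blast

text \<open>By symmetry the complement of a closed set is closed, so it suffices to test the closed
  sets that contain one fixed vertex \<open>a\<close>.\<close>

lemma conn_rootI:
  assumes "a \<in> A"
    and "\<And>X. X \<subseteq> A \<Longrightarrow> a \<in> X \<Longrightarrow> (\<And>u v. u \<in> X \<Longrightarrow> v \<in> A \<Longrightarrow> E u v \<Longrightarrow> v \<in> X) \<Longrightarrow> A \<subseteq> X"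
  shows "conn A"
  unfolding conn_def
proof (intro conjI allI impI)
  show "A \<noteq> {}" using assms(1) by blast
  fix X assume X: "X \<subseteq> A" "X \<noteq> {}" "\<forall>u \<in> X. \<forall>v \<in> A. E u v \<longrightarrow> v \<in> X"
  show "X = A"
  proof (cases "a \<in> X")
    case True
    have "A \<subseteq> X" by (rule assms(2)[OF X(1) True]) (use X(3) in blast)
    with X(1) show ?thesis by blast
  next
    case False
    have "A \<subseteq> A - X"
    proof (rule assms(2))
      show "A - X \<subseteq> A" by blast
      show "a \<in> A - X" using False assms(1) by blast
      fix u v assume "u \<in> A - X" "v \<in> A" "E u v"
      then show "v \<in> A - X" using X(3) sym[of u v] by blast
    qed
    with X(1,2) show ?thesis by blast
  qed
qed

lemma conn_singleton: "conn {a}"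
  by (rule conn_rootI[of a]) auto

lemma comp_subset: "a \<in> A \<Longrightarrow> comp A a \<subseteq> A"
proof
  fix x assume "x \<in> comp A a" "a \<in> A"
  then show "x \<in> A" by (induct rule: comp.induct) auto
qed

lemma conn_comp: "conn (comp A a)"
proof (rule conn_rootI)
  show "a \<in> comp A a" by (rule comp.base)
  fix X assume X: "X \<subseteq> comp A a" "a \<in> X" "\<And>u v. u \<in> X \<Longrightarrow> v \<in> comp A a \<Longrightarrow> E u v \<Longrightarrow> v \<in> X"
  show "comp A a \<subseteq> X"
  proof
    fix x assume "x \<in> comp A a"
    then show "x \<in> X"
    proof (induct rule: comp.induct)
      case (step u v)
      have "v \<in> comp A a" by (rule comp.step) (use step in auto)
      then show ?case using X(3) step by blast
    qed (rule X(2))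
  qed
qed

lemma compsE:
  assumes "D \<in> comps A"
  obtains a where "a \<in> A" "D = comp A a" "a \<in> D"
  using assms comp.base unfolding comps_def by blast

lemma comps_conn: "D \<in> comps A \<Longrightarrow> conn D"
  by (auto elim!: compsE intro: conn_comp)

lemma comps_subset: "D \<in> comps A \<Longrightarrow> D \<subseteq> A"
  unfolding comps_def using comp_subset by blast

lemma comps_closed: "D \<in> comps A \<Longrightarrow> u \<in> D \<Longrightarrow> v \<in> A \<Longrightarrow> E u v \<Longrightarrow> v \<in> D"
  unfolding comps_def using comp.step by blast

lemma Union_comps: "\<Union>(comps A) = A"
proof
  show "\<Union>(comps A) \<subseteq> A" using comps_subset by blast
  show "A \<subseteq> \<Union>(comps A)" unfolding comps_def using comp.base by blast
qed

lemma comps_ex: "a \<in> A \<Longrightarrow> \<exists>D \<in> comps A. a \<in> D"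
  using Union_comps[of A] by blast

lemma conn_subset_comps:
  assumes "conn K" "K \<subseteq> A" "D \<in> comps A" "x \<in> K" "x \<in> D"
  shows "K \<subseteq> D"
proof -
  have "K \<inter> D = K"
  proof (rule conn_closed_eq[OF assms(1)])
    fix u v assume "u \<in> K \<inter> D" "v \<in> K" "E u v"
    then show "v \<in> K \<inter> D" using comps_closed[OF assms(3), of u v] assms(2) by blast
  qed (use assms in blast)+
  then show ?thesis by blast
qed

lemma conn_in_comps:
  assumes "conn K" "K \<subseteq> A"
  shows "\<exists>D \<in> comps A. K \<subseteq> D"
proof -
  obtain x where x: "x \<in> K" using conn_nonempty[OF assms(1)] by blast
  obtain D where D: "D \<in> comps A" "x \<in> D" using comps_ex assms(2) x by blast
  show ?thesis using conn_subset_comps[OF assms D(1) x D(2)] D(1) by blast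
qed

lemma comps_eq:
  assumes "D \<in> comps A" "D' \<in> comps A" "x \<in> D" "x \<in> D'"
  shows "D = D'"
proof
  show "D \<subseteq> D'" by (rule conn_subset_comps[OF comps_conn comps_subset]) (use assms in auto)
  show "D' \<subseteq> D" by (rule conn_subset_comps[OF comps_conn comps_subset]) (use assms in auto)
qed

lemma comps_disjoint: "D \<in> comps A \<Longrightarrow> D' \<in> comps A \<Longrightarrow> D \<noteq> D' \<Longrightarrow> D \<inter> D' = {}"
  using comps_eq by blast

lemma conn_crossing:
  assumes "conn A" "X \<subseteq> A" "X \<noteq> {}" "X \<noteq> A"
  shows "\<exists>u \<in> X. \<exists>v \<in> A - X. E u v"
proof (rule ccontr)
  assume n: "\<not> ?thesis"
  obtain x where x: "x \<in> X" using assms(3) by blast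
  have "X = A" by (rule conn_closed_eq[OF assms(1,2) x]) (use n in blast)
  with assms(4) show False by simp
qed

lemma nb_subset: "nb A C \<subseteq> A - C"
  by (auto simp: nb_def)

text \<open>Some edge leaves \<open>D\<close> inside \<open>A\<close> by
  \<open>conn_crossing\<close>. Its far end cannot lie in \<open>A - B\<close>, where
  \<open>D\<close> is closed, so it lies in \<open>B\<close>.\<close>

lemma comps_adjacent:
  assumes "conn A" "D \<in> comps (A - B)" "A \<inter> B \<noteq> {}"
  shows "\<exists>u \<in> D. \<exists>v \<in> A \<inter> B. E u v"
proof -
  have D: "D \<subseteq> A - B" by (rule comps_subset[OF assms(2)])
  have "\<exists>u \<in> D. \<exists>v \<in> A - D. E u v"
    by (rule conn_crossing[OF assms(1)]) (use D conn_nonempty[OF comps_conn[OF assms(2)]] assms(3) in blast)+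
  then obtain u v where uv: "u \<in> D" "v \<in> A - D" "E u v" by blast
  have "v \<in> B" using comps_closed[OF assms(2) uv(1) _ uv(3)] uv(2) by blast
  with uv show ?thesis by blast
qed

lemma conn_Un:
  assumes "conn A" "conn B" "x \<in> A" "x \<in> B"
  shows "conn (A \<union> B)"
proof (rule conn_rootI)
  show "x \<in> A \<union> B" using assms by blast
  fix X assume X: "X \<subseteq> A \<union> B" "x \<in> X" "\<And>u v. u \<in> X \<Longrightarrow> v \<in> A \<union> B \<Longrightarrow> E u v \<Longrightarrow> v \<in> X"
  have "X \<inter> A = A" by (rule conn_closed_eq[OF assms(1)]) (use X assms in blast)+
  moreover have "X \<inter> B = B" by (rule conn_closed_eq[OF assms(2)]) (use X assms in blast)+
  ultimately show "A \<union> B \<subseteq> X" by blast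
qed

lemma conn_edge:
  assumes "E u v"
  shows "conn {u, v}"
  by (rule conn_rootI[of u]) (use assms in auto)

lemma conn_Un_edge:
  assumes "conn A" "conn B" "u \<in> A" "v \<in> B" "E u v"
  shows "conn (A \<union> B)"
proof -
  have "conn (A \<union> {u, v})" by (rule conn_Un[OF assms(1) conn_edge[OF assms(5)] assms(3)]) simp
  then have "conn ((A \<union> {u, v}) \<union> B)" by (rule conn_Un[OF _ assms(2)]) (use assms in auto)
  then show ?thesis using assms(3,4) by (simp add: insert_absorb)
qed

lemma conn_Un_subset_nb:
  assumes "conn C" "X \<subseteq> nb A C"
  shows "conn (C \<union> X)"
proof -
  obtain c where c: "c \<in> C" using conn_nonempty[OF assms(1)] by blast
  show ?thesis
  proof (rule conn_rootI)
    show "c \<in> C \<union> X" using c by blast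
    fix Y assume Y: "Y \<subseteq> C \<union> X" "c \<in> Y" "\<And>u v. u \<in> Y \<Longrightarrow> v \<in> C \<union> X \<Longrightarrow> E u v \<Longrightarrow> v \<in> Y"
    have C: "Y \<inter> C = C" by (rule conn_closed_eq[OF assms(1)]) (use Y c in blast)+
    show "C \<union> X \<subseteq> Y"
    proof
      fix v assume v: "v \<in> C \<union> X"
      show "v \<in> Y"
      proof (cases "v \<in> C")
        case False
        then have "v \<in> nb A C" using v assms(2) by blast
        then obtain u where "u \<in> C" "E u v" unfolding nb_def by blast
        then show ?thesis using Y(3)[of u v] C v by blast
      qed (use C in blast)
    qed
  qed
qed

text \<open>Every component of \<open>A - B\<close> other than \<open>D\<close> is attached to the
  connected set \<open>B\<close> by an edge, and no such attachment uses \<open>D\<close>.\<close>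

lemma conn_minus_comps:
  assumes "conn A" "conn B" "B \<subseteq> A" "D \<in> comps (A - B)"
  shows "conn (A - D)"
proof -
  obtain b where b: "b \<in> B" using conn_nonempty[OF assms(2)] by blast
  have D: "D \<subseteq> A - B" by (rule comps_subset[OF assms(4)])
  show ?thesis
  proof (rule conn_rootI)
    show "b \<in> A - D" using b assms(3) D by blast
    fix X assume X: "X \<subseteq> A - D" "b \<in> X" "\<And>u v. u \<in> X \<Longrightarrow> v \<in> A - D \<Longrightarrow> E u v \<Longrightarrow> v \<in> X"
    have "X \<inter> B = B" by (rule conn_closed_eq[OF assms(2)]) (use X b D assms(3) in blast)+
    then have BX: "B \<subseteq> X" by blast
    show "A - D \<subseteq> X"
    proof
      fix v assume v: "v \<in> A - D"
      show "v \<in> X"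
      proof (cases "v \<in> B")
        case False
        then obtain D' where D': "D' \<in> comps (A - B)" "v \<in> D'" using comps_ex[of v "A - B"] v by blast
        have disj: "D' \<inter> D = {}" using comps_disjoint[OF D'(1) assms(4)] D' v by blast
        have ne: "A \<inter> B \<noteq> {}" using b assms(3) by blast
        obtain u w where uw: "u \<in> D'" "w \<in> A \<inter> B" "E u w" using comps_adjacent[OF assms(1) D'(1) ne] by blast
        have D'A: "D' \<subseteq> A - D" using comps_subset[OF D'(1)] disj by blast
        have u: "u \<in> X" using X(3)[of w u] uw BX sym D'A by blast
        have "X \<inter> D' = D'"
          by (rule conn_closed_eq[OF comps_conn[OF D'(1)], of _ u]) (use X(3) u uw D'A in blast)+
        then show ?thesis using D'(2) by blast
      qed (use BX in blast)
    qed
  qed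
qed

text \<open>The component of \<open>s'\<close> in \<open>K - {s}\<close> serves as \<open>P\<close>;
  its complement is connected by \<open>conn_minus_comps\<close> with the singleton
  \<open>{s}\<close>.\<close>

lemma conn_split:
  assumes "conn K" "s \<in> K" "s' \<in> K" "s \<noteq> s'"
  shows "\<exists>P. P \<subseteq> K \<and> conn P \<and> conn (K - P) \<and> s \<notin> P \<and> s' \<in> P"
proof -
  obtain P where P: "P \<in> comps (K - {s})" "s' \<in> P" using comps_ex[of s' "K - {s}"] assms by blast
  show ?thesis
    using conn_minus_comps[OF assms(1) conn_singleton _ P(1)] comps_conn[OF P(1)] comps_subset[OF P(1)] P(2) assms(2)
    by blast
qed

primrec heavy :: "nat \<Rightarrow> 'a set \<Rightarrow> bool" where
  "heavy 0 A \<longleftrightarrow> conn A"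
| "heavy (Suc h) A \<longleftrightarrow> conn A \<and>
     (\<exists>P Q R. P \<subseteq> A \<and> Q \<subseteq> A \<and> R \<subseteq> A \<and> P \<inter> Q = {} \<and> P \<inter> R = {} \<and> Q \<inter> R = {} \<and>
        heavy h P \<and> heavy h Q \<and> heavy h R \<and> conn (A - P) \<and> conn (A - Q) \<and> conn (A - R))"

lemma heavy_conn: "heavy h A \<Longrightarrow> conn A"
  by (cases h) auto

end

section \<open>Path decompositions as lists of bags\<close>

text \<open>This is the interval condition of a path decomposition in a form suited to recursion;
  \<open>interval_list_nth\<close> recovers the usual one. The unspecified \<open>hd []\<close> is
  harmless, since for \<open>L = []\<close> the intersection is empty.\<close>

fun interval_list :: "'a set list \<Rightarrow> bool" where
  "interval_list [] \<longleftrightarrow> True"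
| "interval_list (X # L) \<longleftrightarrow> interval_list L \<and> X \<inter> \<Union>(set L) \<subseteq> hd L"

lemma interval_list_append:
  assumes "interval_list L" "interval_list L'"
    and "L \<noteq> [] \<Longrightarrow> L' \<noteq> [] \<Longrightarrow> \<Union>(set L) \<inter> \<Union>(set L') \<subseteq> last L \<inter> hd L'"
  shows "interval_list (L @ L')"
  using assms
proof (induct L)
  case (Cons X L)
  show ?case
  proof (cases "L = []")
    case True
    show ?thesis
    proof (cases "L' = []")
      case False
      have "X \<inter> \<Union>(set L') \<subseteq> hd L'" using Cons.prems(3)[OF _ False] True by auto
      then show ?thesis using True Cons.prems(2) by simp
    qed (use True in simp)
  next
    case False
    have "interval_list (L @ L')"
    proof (rule Cons.hyps)
      show "interval_list L" "interval_list L'" using Cons.prems(1,2) by simp_all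
      assume "L' \<noteq> []"
      then have "\<Union>(set (X # L)) \<inter> \<Union>(set L') \<subseteq> last (X # L) \<inter> hd L'" by (intro Cons.prems(3)) simp_all
      then show "\<Union>(set L) \<inter> \<Union>(set L') \<subseteq> last L \<inter> hd L'" using False by auto
    qed
    moreover have "X \<inter> \<Union>(set (L @ L')) \<subseteq> hd L"
    proof
      fix v assume v: "v \<in> X \<inter> \<Union>(set (L @ L'))"
      have X: "X \<inter> \<Union>(set L) \<subseteq> hd L" using Cons.prems(1) by simp
      show "v \<in> hd L"
      proof (cases "v \<in> \<Union>(set L')")
        case True
        then have "L' \<noteq> []" by auto
        then have "\<Union>(set (X # L)) \<inter> \<Union>(set L') \<subseteq> last (X # L) \<inter> hd L'" by (intro Cons.prems(3)) simp_all
        \<comment> \<open>A vertex shared with \<open>L'\<close> lies in the last bag of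
          \<open>L\<close>, so it recurs in \<open>L\<close> and the interval condition of
          \<open>X # L\<close> applies.\<close>
        then have "v \<in> last L" using True v False by auto
        then have "v \<in> \<Union>(set L)" using False last_in_set by blast
        then show ?thesis using X v by blast
      qed (use X v in auto)
    qed
    ultimately show ?thesis using False by simp
  qed
qed simp

lemma interval_list_map_Un:
  assumes "interval_list L"
  shows "interval_list (map (\<lambda>X. X \<union> Z) L)"
  using assms
proof (induct L)
  case (Cons X L)
  show ?case
  proof (cases "L = []")
    case False
    then have "hd (map (\<lambda>X. X \<union> Z) L) = hd L \<union> Z" by (simp add: hd_map)
    then show ?thesis using Cons by auto
  qed simp
qed simp

text \<open>In the essential case \<open>i = 0\<close>, a vertex of the first bag that recurs later
  lies in \<open>hd L\<close>, so the induction hypothesis applies to the tail from index 0.\<close>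

lemma interval_list_nth:
  assumes "interval_list L" "i \<le> j" "j \<le> k" "k < length L" "v \<in> L ! i" "v \<in> L ! k"
  shows "v \<in> L ! j"
  using assms
proof (induct L arbitrary: i j k)
  case (Cons X L)
  show ?case
  proof (cases i)
    case (Suc i')
    then show ?thesis using Cons.hyps[of i' "j - 1" "k - 1"] Cons.prems
      by (cases j; cases k) auto
  next
    case 0
    show ?thesis
    proof (cases j)
      case (Suc j')
      then obtain k' where k: "k = Suc k'" using Cons.prems(3) by (cases k) auto
      have vk: "v \<in> L ! k'" "k' < length L" using Cons.prems k by auto
      have "v \<in> \<Union>(set L)" using vk(1) nth_mem[OF vk(2)] by blast
      then have "v \<in> hd L" using Cons.prems(1,5) 0 by auto
      moreover have "hd L = L ! 0" using vk(2) by (cases L) auto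
      ultimately have "v \<in> L ! j'"
        using Cons.hyps[of 0 j' k'] vk Cons.prems(1,3) k Suc by auto
      then show ?thesis using Suc by simp
    qed (use Cons.prems 0 in simp)
  qed
qed simp

context symmetric_relation begin

definition path_bags :: "nat \<Rightarrow> 'a set \<Rightarrow> 'a set list \<Rightarrow> bool" where
  "path_bags k A L \<longleftrightarrow> \<Union>(set L) = A \<and> interval_list L \<and> (\<forall>X \<in> set L. card X \<le> k) \<and>
     (\<forall>u \<in> A. \<forall>v \<in> A. E u v \<longrightarrow> (\<exists>X \<in> set L. u \<in> X \<and> v \<in> X))"

lemma path_bags_empty: "path_bags k {} []"
  by (simp add: path_bags_def)

lemma path_bags_Un:
  assumes "path_bags k A L" "path_bags k B L'" "A \<inter> B = {}" "\<And>u v. u \<in> A \<Longrightarrow> v \<in> B \<Longrightarrow> \<not> E u v"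
  shows "path_bags k (A \<union> B) (L @ L')"
  unfolding path_bags_def
proof (intro conjI ballI impI)
  show "\<Union>(set (L @ L')) = A \<union> B" using assms(1,2) by (simp add: path_bags_def)
  show "interval_list (L @ L')"
    using assms(1-3) by (intro interval_list_append) (simp_all add: path_bags_def)
  show "card X \<le> k" if "X \<in> set (L @ L')" for X
    using that assms(1,2) by (auto simp: path_bags_def)
  fix u v assume uv: "u \<in> A \<union> B" "v \<in> A \<union> B" "E u v"
  have n: "\<not> (u \<in> A \<and> v \<in> B)" "\<not> (v \<in> A \<and> u \<in> B)"
    using assms(4) sym uv(3) by auto
  from n uv(1,2) have "u \<in> A \<and> v \<in> A \<or> u \<in> B \<and> v \<in> B" by blast
  moreover have "\<exists>X \<in> set L. u \<in> X \<and> v \<in> X" if "u \<in> A" "v \<in> A"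
    using assms(1) uv(3) that unfolding path_bags_def by simp
  moreover have "\<exists>X \<in> set L'. u \<in> X \<and> v \<in> X" if "u \<in> B" "v \<in> B"
    using assms(2) uv(3) that unfolding path_bags_def by simp
  ultimately show "\<exists>X \<in> set (L @ L'). u \<in> X \<and> v \<in> X"
    unfolding set_append bex_Un by satx
qed

text \<open>No edge joins distinct components, so their bag lists can simply be
  concatenated.\<close>

lemma path_bags_Union_comps:
  assumes "finite F" "F \<subseteq> comps A" "\<And>D. D \<in> F \<Longrightarrow> \<exists>L. path_bags k D L"
  shows "\<exists>L. path_bags k (\<Union>F) L"
  using assms
proof (induct F)
  case empty
  then show ?case using path_bags_empty by auto
next
  case (insert D F)
  obtain L where L: "path_bags k (\<Union>F) L" using insert by auto
  obtain L' where L': "path_bags k D L'" using insert.prems(2) by auto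
  have D: "D \<in> comps A" and F: "F \<subseteq> comps A" using insert.prems by auto
  have disj: "D \<inter> \<Union>F = {}"
    using comps_disjoint[OF D] F insert.hyps(2) by blast
  have "path_bags k (D \<union> \<Union>F) (L' @ L)"
  proof (rule path_bags_Un[OF L' L disj])
    fix u v assume "u \<in> D" "v \<in> \<Union>F"
    moreover have "v \<in> A" using calculation(2) F comps_subset by blast
    ultimately show "\<not> E u v" using comps_closed[OF D, of u v] disj by blast
  qed
  then show ?case by auto
qed

text \<open>\<open>Z\<close> comes first and is added to every bag for \<open>P\<close>, so it stays
  available until the list for \<open>D\<close> begins. From there on only \<open>K\<close> is
  needed, because it contains all neighbours of \<open>D\<close> in \<open>Z\<close>; this is why
  \<open>K\<close> has to lie in \<open>hd L'\<close>.\<close>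

lemma path_bags_glue:
  assumes fin: "finite Z" "card Z \<le> k"
    and P: "path_bags m P L"
    and D: "path_bags (k + m) (D \<union> K) L'" "K \<subseteq> hd L'" "K \<subseteq> Z" "\<And>u v. u \<in> D \<Longrightarrow> v \<in> Z \<Longrightarrow> E u v \<Longrightarrow> v \<in> K"
    and disj: "P \<inter> D = {}" "P \<inter> Z = {}" "D \<inter> Z = {}" "\<And>u v. u \<in> P \<Longrightarrow> v \<in> D \<Longrightarrow> \<not> E u v"
  shows "path_bags (k + m) (Z \<union> P \<union> D) (Z # map (\<lambda>X. X \<union> Z) L @ L')"
  unfolding path_bags_def
proof (intro conjI ballI impI)
  have UL: "\<Union>(set L) = P" and UL': "\<Union>(set L') = D \<union> K" using P D by (simp_all add: path_bags_def)
  show "\<Union>(set (Z # map (\<lambda>X. X \<union> Z) L @ L')) = Z \<union> P \<union> D"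
    using UL UL' D(3) by auto
  have "interval_list ((Z # map (\<lambda>X. X \<union> Z) L) @ L')"
  proof (rule interval_list_append)
    have "interval_list (map (\<lambda>X. X \<union> Z) L)"
      using P by (simp add: path_bags_def interval_list_map_Un)
    moreover have "Z \<inter> \<Union>(set (map (\<lambda>X. X \<union> Z) L)) \<subseteq> hd (map (\<lambda>X. X \<union> Z) L)"
      by (cases L) auto
    ultimately show "interval_list (Z # map (\<lambda>X. X \<union> Z) L)" by simp
    show "interval_list L'" using D by (simp add: path_bags_def)
    have "Z \<subseteq> last (Z # map (\<lambda>X. X \<union> Z) L)"
      by (cases L rule: rev_cases) auto
    moreover have "\<Union>(set (Z # map (\<lambda>X. X \<union> Z) L)) \<subseteq> Z \<union> P" using UL by auto
    ultimately show "\<Union>(set (Z # map (\<lambda>X. X \<union> Z) L)) \<inter> \<Union>(set L') \<subseteq> last (Z # map (\<lambda>X. X \<union> Z) L) \<inter> hd L'"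
      using UL' D(2,3) disj(1-3) by blast
  qed
  then show "interval_list (Z # map (\<lambda>X. X \<union> Z) L @ L')" by simp
  show "card X \<le> k + m" if X: "X \<in> set (Z # map (\<lambda>X. X \<union> Z) L @ L')" for X
  proof -
    have "card (Y \<union> Z) \<le> k + m" if "Y \<in> set L" for Y
      using card_Un_le[of Y Z] P that fin unfolding path_bags_def by fastforce
    then show ?thesis using X D(1) fin unfolding path_bags_def by auto
  qed
  fix u v assume uv: "u \<in> Z \<union> P \<union> D" "v \<in> Z \<union> P \<union> D" "E u v"
  have EL: "\<exists>X \<in> set L. u \<in> X \<and> v \<in> X" if "u \<in> P" "v \<in> P"
    using P that uv(3) unfolding path_bags_def by simp
  have EL': "\<exists>X \<in> set L'. u \<in> X \<and> v \<in> X" if "u \<in> D \<union> K" "v \<in> D \<union> K"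
    using D that uv(3) unfolding path_bags_def by simp
  have vu: "E v u" using sym uv(3) by simp
  have PX: "\<exists>X \<in> set L. x \<in> X" if "x \<in> P" for x using UL that by blast
  have n: "\<not> (u \<in> P \<and> v \<in> D)" "\<not> (u \<in> D \<and> v \<in> P)" using disj(4) uv(3) vu by blast+
  consider "u \<in> Z" "v \<in> Z" | "u \<in> P" "v \<in> P" | "u \<in> P" "v \<in> Z" | "u \<in> Z" "v \<in> P"
    | "u \<in> D \<union> K" "v \<in> D \<union> K"
  proof -
    have "u \<in> D \<Longrightarrow> v \<in> Z \<Longrightarrow> v \<in> K" "v \<in> D \<Longrightarrow> u \<in> Z \<Longrightarrow> u \<in> K"
      using D(4) uv(3) vu by blast+
    moreover have "u \<in> Z \<or> u \<in> P \<or> u \<in> D" "v \<in> Z \<or> v \<in> P \<or> v \<in> D" using uv(1,2) by simp_all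
    ultimately show ?thesis using n that by (elim disjE) simp_all
  qed
  then show "\<exists>X \<in> set (Z # map (\<lambda>X. X \<union> Z) L @ L'). u \<in> X \<and> v \<in> X"
  proof cases
    case 1
    then show ?thesis by simp
  next
    case 2
    then obtain X where "X \<in> set L" "u \<in> X" "v \<in> X" using EL by metis
    then show ?thesis by (intro bexI[of _ "X \<union> Z"]) simp_all
  next
    case 3
    then obtain X where "X \<in> set L" "u \<in> X" using PX by metis
    then show ?thesis using 3 by (intro bexI[of _ "X \<union> Z"]) simp_all
  next
    case 4
    then obtain X where "X \<in> set L" "v \<in> X" using PX by metis
    then show ?thesis using 4 by (intro bexI[of _ "X \<union> Z"]) simp_all
  next
    case 5
    then obtain X where "X \<in> set L'" "u \<in> X" "v \<in> X" using EL' by metis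
    then show ?thesis by (intro bexI[of _ X]) simp_all
  qed
qed

text \<open>\<open>Q\<close> singles out the component in which the walk continues, and
  \<open>uniq\<close> allows at most one. All others have bags of size at most \<open>m\<close> and
  are absorbed at \<open>Z\<close>. Having \<open>Z\<close> in the first bag lets the result serve
  as the hypothesis \<open>heavy\<close> of the next gluing.\<close>

lemma path_bags_glue_comps:
  assumes fin: "finite R" and Z: "Z \<subseteq> R" "card Z \<le> k"
    and uniq: "\<And>D D'. D \<in> comps (R - Z) \<Longrightarrow> D' \<in> comps (R - Z) \<Longrightarrow> Q D \<Longrightarrow> Q D' \<Longrightarrow> D = D'"
    and light: "\<And>D. D \<in> comps (R - Z) \<Longrightarrow> \<not> Q D \<Longrightarrow> \<exists>L. path_bags m D L"
    and heavy: "\<And>D. D \<in> comps (R - Z) \<Longrightarrow> Q D \<Longrightarrow>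
      \<exists>L K. path_bags (k + m) (D \<union> K) L \<and> K \<subseteq> hd L \<and> K \<subseteq> Z \<and> (\<forall>u \<in> D. \<forall>v \<in> Z. E u v \<longrightarrow> v \<in> K)"
  shows "\<exists>L. path_bags (k + m) R L \<and> Z \<subseteq> hd L"
proof -
  let ?F = "{D \<in> comps (R - Z). \<not> Q D}" and ?D = "\<Union>{D \<in> comps (R - Z). Q D}"
  have "finite (comps (R - Z))" using fin by (simp add: comps_def)
  then obtain L where L: "path_bags m (\<Union>?F) L"
    using path_bags_Union_comps[of ?F "R - Z" m] light by auto
  have "\<exists>L K. path_bags (k + m) (?D \<union> K) L \<and> K \<subseteq> hd L \<and> K \<subseteq> Z \<and> (\<forall>u \<in> ?D. \<forall>v \<in> Z. E u v \<longrightarrow> v \<in> K)"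
  proof (cases "\<exists>D \<in> comps (R - Z). Q D")
    case True
    then obtain D where D: "D \<in> comps (R - Z)" "Q D" by blast
    then have "{D \<in> comps (R - Z). Q D} = {D}" using uniq by blast
    then show ?thesis using heavy[OF D] by simp
  next
    case False
    then have e: "?D = {}" by blast
    \<comment> \<open>With no component left to enter, the list ends. The choice
      \<open>K = {}\<close> satisfies the condition on \<open>hd []\<close>.\<close>
    show ?thesis unfolding e using path_bags_empty by (intro exI[of _ "[]"] exI[of _ "{}"]) simp
  qed
  then obtain L' K where L': "path_bags (k + m) (?D \<union> K) L'" "K \<subseteq> hd L'" "K \<subseteq> Z"
      "\<forall>u \<in> ?D. \<forall>v \<in> Z. E u v \<longrightarrow> v \<in> K" by (elim exE conjE) (rule that)
  have FZ: "\<Union>?F \<subseteq> R - Z" and DZ: "?D \<subseteq> R - Z" using comps_subset by blast+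
  have "path_bags (k + m) (Z \<union> \<Union>?F \<union> ?D) (Z # map (\<lambda>X. X \<union> Z) L @ L')"
  proof (rule path_bags_glue[OF _ Z(2) L L'(1-3)])
    show "finite Z" using fin Z(1) finite_subset by blast
    show "v \<in> K" if "u \<in> ?D" "v \<in> Z" "E u v" for u v using bspec[OF bspec[OF L'(4) that(1)] that(2)] that(3) by (rule mp)
    show disj: "\<Union>?F \<inter> ?D = {}"
    proof (rule equals0I)
      fix x assume "x \<in> \<Union>?F \<inter> ?D"
      then obtain D D' where D: "D \<in> comps (R - Z)" "\<not> Q D" "x \<in> D" "D' \<in> comps (R - Z)" "Q D'" "x \<in> D'"
        by auto
      have "D = D'" by (rule comps_eq[OF D(1,4,3,6)])
      with D(2,5) show False by simp
    qed
    show "\<Union>?F \<inter> Z = {}" "?D \<inter> Z = {}" using FZ DZ by blast+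
    fix u v assume uv: "u \<in> \<Union>?F" "v \<in> ?D"
    then obtain D where D: "D \<in> comps (R - Z)" "\<not> Q D" "u \<in> D" by blast
    show "\<not> E u v"
    proof
      assume "E u v"
      then have "v \<in> D" using comps_closed[OF D(1,3)] uv(2) DZ by blast
      then show False using disj D uv(2) by blast
    qed
  qed
  moreover have "Z \<union> \<Union>?F \<union> ?D = R" using Union_comps[of "R - Z"] Z(1) by blast
  ultimately show ?thesis by (intro exI[of _ "Z # map (\<lambda>X. X \<union> Z) L @ L'"]) simp
qed

end

section \<open>Walking along separators\<close>

text \<open>
  The set system \<open>small\<close> provides the separators: the subsets of bags if \<open>h > 0\<close>, and the sets with
  at most two elements if \<open>h = 0\<close>.
\<close>

locale separators = symmetric_relation +
  fixes A :: "'a set" and small :: "'a set \<Rightarrow> bool" and k m h :: nat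
  assumes conn_A: "conn A" and finite_A: "finite A" and not_heavy: "\<not> heavy (Suc h) A"
    and small_mono: "small Y \<Longrightarrow> X \<subseteq> Y \<Longrightarrow> small X"
    and small_card: "small X \<Longrightarrow> card X \<le> k"
    and small_singleton: "v \<in> A \<Longrightarrow> small {v}"
    and separate: "C \<subseteq> A \<Longrightarrow> C \<noteq> A \<Longrightarrow> conn C \<Longrightarrow> conn (A - C) \<Longrightarrow> small (nb A C) \<Longrightarrow>
      \<exists>Z. small Z \<and> nb A C \<subseteq> Z \<and> Z \<subseteq> C \<union> nb A C \<and> Z \<inter> C \<noteq> {} \<and> (\<forall>D \<in> comps (C - Z). conn (A - D))"
    and light: "D \<subseteq> A \<Longrightarrow> conn D \<Longrightarrow> \<not> heavy h D \<Longrightarrow> \<exists>L. path_bags m D L"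
begin

definition side :: "'a set \<Rightarrow> bool" where
  "side C \<longleftrightarrow> C \<subseteq> A \<and> C \<noteq> A \<and> conn C \<and> conn (A - C) \<and> small (nb A C)"

text \<open>Otherwise \<open>P\<close>, \<open>Q\<close> and \<open>R\<close> would be three parts
  that make \<open>A\<close> heavy of order \<open>h + 1\<close>.\<close>

lemma at_most_two_heavy:
  assumes "side P" "side Q" "side R" "P \<inter> Q = {}" "P \<inter> R = {}" "heavy h P" "heavy h Q" "heavy h R"
  shows "Q \<inter> R \<noteq> {}"
proof
  assume "Q \<inter> R = {}"
  with assms have "P \<subseteq> A \<and> Q \<subseteq> A \<and> R \<subseteq> A \<and> P \<inter> Q = {} \<and> P \<inter> R = {} \<and> Q \<inter> R = {} \<and>
      heavy h P \<and> heavy h Q \<and> heavy h R \<and> conn (A - P) \<and> conn (A - Q) \<and> conn (A - R)"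
    by (simp add: side_def)
  then have "heavy (Suc h) A"
    unfolding heavy.simps by (intro conjI[OF conn_A]) (rule exI)+
  with not_heavy show False by (rule notE)
qed

text \<open>A neighbour of a component \<open>D\<close> of \<open>C - Z\<close> lies in
  \<open>Z\<close>: inside \<open>C\<close> because \<open>D\<close> is closed in
  \<open>C - Z\<close>, and outside \<open>C\<close> because it is then a neighbour of
  \<open>C\<close>. Hence smallness passes from \<open>Z\<close> to \<open>nb A D\<close>.\<close>

lemma side_separate:
  assumes "side C"
  shows "\<exists>Z. small Z \<and> nb A C \<subseteq> Z \<and> Z \<subseteq> C \<union> nb A C \<and> Z \<inter> C \<noteq> {} \<and>
    (\<forall>D \<in> comps (C - Z). side D \<and> nb A D \<subseteq> Z)"
proof -
  have C: "C \<subseteq> A" "C \<noteq> A" using assms by (simp_all add: side_def)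
  obtain Z where Z: "small Z" "nb A C \<subseteq> Z" "Z \<subseteq> C \<union> nb A C" "Z \<inter> C \<noteq> {}" "\<forall>D \<in> comps (C - Z). conn (A - D)"
    using separate[of C] assms unfolding side_def by metis
  have "side D \<and> nb A D \<subseteq> Z" if D: "D \<in> comps (C - Z)" for D
  proof -
    have DC: "D \<subseteq> C - Z" by (rule comps_subset[OF D])
    have nb: "nb A D \<subseteq> Z"
    proof
      fix v assume "v \<in> nb A D"
      then obtain u where uv: "v \<in> A" "v \<notin> D" "u \<in> D" "E u v" unfolding nb_def by blast
      show "v \<in> Z"
      proof (cases "v \<in> C")
        case True
        then show ?thesis using comps_closed[OF D uv(3) _ uv(4)] uv(2) by blast
      next
        case False
        then have "v \<in> nb A C" unfolding nb_def using uv DC by blast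
        then show ?thesis using Z(2) by blast
      qed
    qed
    have "D \<noteq> A" "D \<subseteq> A" using DC C by blast+
    then show ?thesis unfolding side_def using nb small_mono[OF Z(1) nb] comps_conn[OF D] Z(5) D by blast
  qed
  with Z(1-4) show ?thesis by blast
qed

text \<open>Induction on the size of \<open>C\<close>: the separator meets \<open>C\<close>, so the
  components it leaves are smaller. As \<open>C0\<close> is a heavy side disjoint from all of them,
  two heavy ones would contradict \<open>at_most_two_heavy\<close>. The boundary
  \<open>nb A C\<close> in the first bag is what the previous separator is glued along.\<close>

lemma side_path_bags:
  assumes "side C0" "heavy h C0" "side C" "C0 \<inter> C = {}"
  shows "\<exists>L. path_bags (k + m) (C \<union> nb A C) L \<and> nb A C \<subseteq> hd L"
  using assms(3,4)
proof (induct "card C" arbitrary: C rule: less_induct)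
  case less
  obtain Z where Z: "small Z" "nb A C \<subseteq> Z" "Z \<subseteq> C \<union> nb A C" "Z \<inter> C \<noteq> {}"
      "\<forall>D \<in> comps (C - Z). side D \<and> nb A D \<subseteq> Z"
    using side_separate[OF less.prems(1)] by metis
  have CA: "C \<subseteq> A" using less.prems(1) by (simp add: side_def)
  let ?R = "C \<union> nb A C"
  have nbA: "nb A C \<subseteq> A - C" by (rule nb_subset)
  \<comment> \<open>All of \<open>nb A C\<close> lies in \<open>Z\<close>, so only components of
    \<open>C - Z\<close> remain.\<close>
  have R: "?R - Z = C - Z" using Z(2) by blast
  have fR: "finite ?R" using finite_A CA nbA finite_subset by blast
  have "\<exists>L. path_bags (k + m) ?R L \<and> Z \<subseteq> hd L"
  proof (rule path_bags_glue_comps[where Q = "heavy h", OF fR Z(3) small_card[OF Z(1)]], unfold R)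
    fix D assume D: "D \<in> comps (C - Z)"
    have DC: "D \<subseteq> C - Z" by (rule comps_subset[OF D])
    have sD: "side D" "nb A D \<subseteq> Z" using Z(5) D by auto
    show "\<exists>L. path_bags m D L" if "\<not> heavy h D"
      using light[OF _ comps_conn[OF D] that] DC CA by blast
    show "\<exists>L K. path_bags (k + m) (D \<union> K) L \<and> K \<subseteq> hd L \<and> K \<subseteq> Z \<and> (\<forall>u \<in> D. \<forall>v \<in> Z. E u v \<longrightarrow> v \<in> K)"
    proof -
      have "D \<subset> C" using DC Z(4) by blast
      then have "card D < card C" using psubset_card_mono finite_subset[OF CA finite_A] by blast
      moreover have "C0 \<inter> D = {}" using less.prems(2) DC by blast
      ultimately obtain L where L: "path_bags (k + m) (D \<union> nb A D) L" "nb A D \<subseteq> hd L"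
        using less.hyps sD(1) by metis
      have "v \<in> nb A D" if "u \<in> D" "v \<in> Z" "E u v" for u v
      proof -
        have "v \<in> A" using that(2) Z(3) CA nbA by blast
        then show ?thesis unfolding nb_def using that DC by blast
      qed
      then show ?thesis using L sD(2) by (intro exI[of _ L] exI[of _ "nb A D"]) simp
    qed
    fix D' assume D': "D' \<in> comps (C - Z)" "heavy h D" "heavy h D'"
    have "D \<inter> D' \<noteq> {}"
    proof (rule at_most_two_heavy[OF assms(1) sD(1) _ _ _ assms(2) D'(2,3)])
      show "side D'" using Z(5) D' by blast
      show "C0 \<inter> D = {}" "C0 \<inter> D' = {}" using comps_subset[OF D'(1)] DC less.prems(2) by blast+
    qed
    then show "D = D'" using comps_disjoint[OF D D'(1)] by blast
  qed
  then show ?case using Z(2) by blast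
qed

text \<open>Without heavy sides, a single vertex serves as separator and everything it leaves is
  light. Otherwise the walk starts at a minimal heavy side \<open>C\<close>, whose separator leaves
  only light components inside \<open>C\<close>. It continues outside \<open>C\<close>, where
  \<open>C\<close> takes the role of \<open>C0\<close> in \<open>side_path_bags\<close>.\<close>

lemma path_bags_exists: "\<exists>L. path_bags (k + m) A L"
proof (cases "\<exists>C. side C \<and> heavy h C")
  case False
  obtain a where a: "a \<in> A" using conn_nonempty[OF conn_A] by blast
  have nh: "\<not> heavy h D" if D: "D \<in> comps (A - {a})" for D
  proof -
    have DA: "D \<subseteq> A - {a}" by (rule comps_subset[OF D])
    have "nb A D \<subseteq> {a}" unfolding nb_def using comps_closed[OF D] by blast
    then have "small (nb A D)" using small_mono small_singleton[OF a] by blast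
    moreover have "conn (A - D)" using conn_minus_comps[OF conn_A conn_singleton _ D] a by blast
    ultimately have "side D" unfolding side_def using DA comps_conn[OF D] a by blast
    then show ?thesis using False by blast
  qed
  have "{a} \<subseteq> A" using a by blast
  then have "\<exists>L. path_bags (k + m) A L \<and> {a} \<subseteq> hd L"
  proof (rule path_bags_glue_comps[where Q = "heavy h", OF finite_A _ small_card[OF small_singleton[OF a]]])
    fix D assume D: "D \<in> comps (A - {a})"
    then have "D \<subseteq> A" using comps_subset by blast
    then show "\<exists>L. path_bags m D L" using light comps_conn[OF D] nh[OF D] by blast
  qed (use nh in blast)+
  then show ?thesis by blast
next
  case True
  define C where "C = arg_min card (\<lambda>C. side C \<and> heavy h C)"
  have C: "side C" "heavy h C" and min: "\<And>D. side D \<Longrightarrow> heavy h D \<Longrightarrow> card C \<le> card D"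
    using arg_min_nat_lemma[of "\<lambda>C. side C \<and> heavy h C" _ card] True unfolding C_def by blast+
  obtain Z where Z: "small Z" "nb A C \<subseteq> Z" "Z \<subseteq> C \<union> nb A C" "Z \<inter> C \<noteq> {}"
      "\<forall>D \<in> comps (C - Z). side D \<and> nb A D \<subseteq> Z"
    using side_separate[OF C(1)] by metis
  have CA: "C \<subseteq> A" "conn C" using C(1) by (simp_all add: side_def)
  have nbA: "nb A C \<subseteq> A - C" by (rule nb_subset)
  have ZA: "Z \<subseteq> A" using Z(3) CA nbA by blast
  let ?B = "C \<union> nb A C"
  have cB: "conn ?B" by (rule conn_Un_subset_nb[OF CA(2) order_refl])
  have comps: "D \<in> comps (C - Z) \<and> \<not> heavy h D \<or> side D \<and> C \<inter> D = {} \<and> nb A D \<subseteq> Z" if D: "D \<in> comps (A - Z)" for D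
  proof (cases "D \<inter> C = {}")
    case False
    then obtain x where x: "x \<in> D" "x \<in> C" by blast
    have DA: "D \<subseteq> A - Z" by (rule comps_subset[OF D])
    obtain D' where D': "D' \<in> comps (C - Z)" "x \<in> D'" using comps_ex[of x "C - Z"] x DA by blast
    have D'C: "D' \<subseteq> C - Z" by (rule comps_subset[OF D'(1)])
    \<comment> \<open>\<open>Z\<close> contains all neighbours of \<open>C\<close>, so a step from
      \<open>D'\<close> that avoids \<open>Z\<close> stays inside \<open>C\<close>.\<close>
    have "D' = D"
    proof (rule conn_closed_eq[OF comps_conn[OF D] _ D'(2)])
      show "D' \<subseteq> D"
        by (rule conn_subset_comps[OF comps_conn[OF D'(1)] _ D D'(2) x(1)]) (use D'C CA in blast)
      fix u v assume uv: "u \<in> D'" "v \<in> D" "E u v"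
      have "v \<in> C" using uv Z(2) D'C DA unfolding nb_def by blast
      then show "v \<in> D'" using comps_closed[OF D'(1) uv(1) _ uv(3)] uv(2) DA by blast
    qed
    moreover have "\<not> heavy h D'"
    proof
      assume "heavy h D'"
      then have "card C \<le> card D'" using min[of D'] D'(1) Z(5) by blast
      moreover have "D' \<subset> C" using D'C Z(4) by blast
      ultimately show False using psubset_card_mono finite_subset[OF CA(1) finite_A] not_less by blast
    qed
    ultimately show ?thesis using D'(1) by blast
  next
    case True
    have DA: "D \<subseteq> A - Z" by (rule comps_subset[OF D])
    have DB: "D \<subseteq> A - ?B" using DA True Z(2) by blast
    obtain x where x: "x \<in> D" using conn_nonempty[OF comps_conn[OF D]] by blast
    obtain D' where D': "D' \<in> comps (A - ?B)" "x \<in> D'" using comps_ex[of x "A - ?B"] x DB by blast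
    have D'B: "D' \<subseteq> A - ?B" by (rule comps_subset[OF D'(1)])
    have "D' \<subseteq> D"
      by (rule conn_subset_comps[OF comps_conn[OF D'(1)] _ D D'(2) x]) (use D'B Z(3) in blast)
    moreover have "D \<subseteq> D'"
      by (rule conn_subset_comps[OF comps_conn[OF D] DB D'(1) x D'(2)])
    \<comment> \<open>Since \<open>nb A C \<subseteq> Z \<subseteq> C \<union> nb A C\<close>, a
      component of \<open>A - Z\<close> that misses \<open>C\<close> is also a component of
      \<open>A - (C \<union> nb A C)\<close>. As \<open>C \<union> nb A C\<close> is connected,
      \<open>A - D\<close> will be connected too.\<close>
    ultimately have D'': "D \<in> comps (A - ?B)" using D'(1) by simp
    have nb: "nb A D \<subseteq> Z"
      unfolding nb_def using comps_closed[OF D] by blast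
    have "v \<in> ?B" if vD: "v \<in> nb A D" for v
    proof -
      obtain u where "v \<in> A" "v \<notin> D" "u \<in> D" "E u v" using vD unfolding nb_def by blast
      then show ?thesis using comps_closed[OF D'', of u v] by blast
    qed
    then have "nb A D \<subseteq> ?B" by blast
    moreover have "conn (A - D)" by (rule conn_minus_comps[OF conn_A cB _ D'']) (use CA nbA in blast)
    moreover have "D \<noteq> A" using True conn_nonempty[OF CA(2)] CA(1) by blast
    ultimately have "side D" unfolding side_def using small_mono[OF Z(1) nb] comps_conn[OF D] DA by blast
    then show ?thesis using True nb by blast
  qed
  have "\<exists>L. path_bags (k + m) A L \<and> Z \<subseteq> hd L"
  proof (rule path_bags_glue_comps[where Q = "heavy h", OF finite_A ZA small_card[OF Z(1)]])
    fix D assume D: "D \<in> comps (A - Z)"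
    have DA: "D \<subseteq> A - Z" by (rule comps_subset[OF D])
    show "\<exists>L. path_bags m D L" if "\<not> heavy h D"
      using light[OF _ comps_conn[OF D] that] DA by blast
    show "\<exists>L K. path_bags (k + m) (D \<union> K) L \<and> K \<subseteq> hd L \<and> K \<subseteq> Z \<and> (\<forall>u \<in> D. \<forall>v \<in> Z. E u v \<longrightarrow> v \<in> K)"
      if hD: "heavy h D"
    proof -
      have sD: "side D" "C \<inter> D = {}" "nb A D \<subseteq> Z" using comps[OF D] hD by blast+
      obtain L where L: "path_bags (k + m) (D \<union> nb A D) L" "nb A D \<subseteq> hd L"
        using side_path_bags[OF C sD(1,2)] by metis
      have "v \<in> nb A D" if "u \<in> D" "v \<in> Z" "E u v" for u v
        unfolding nb_def using that DA ZA by blast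
      then show ?thesis using L sD(3) by (intro exI[of _ L] exI[of _ "nb A D"]) simp
    qed
    fix D' assume D': "D' \<in> comps (A - Z)" "heavy h D" "heavy h D'"
    have "D \<inter> D' \<noteq> {}"
      using at_most_two_heavy[OF C(1) _ _ _ _ C(2) D'(2,3)] comps[OF D] comps[OF D'(1)] D'(2,3) by blast
    then show "D = D'" using comps_disjoint[OF D D'(1)] by blast
  qed
  then show ?thesis by blast
qed

end

section \<open>Separators from a tree decomposition\<close>

context symmetric_relation begin

text \<open>Let \<open>Y\<close> be closed in \<open>A - {x}\<close>. If \<open>y\<close> is in
  \<open>Y\<close>, then \<open>insert x Y\<close> is closed in \<open>A\<close>. If not, no vertex
  of \<open>Y\<close> is adjacent to \<open>x\<close>, and \<open>Y\<close> itself is closed in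
  \<open>A\<close>.\<close>

lemma conn_remove_leaf:
  assumes "conn A" "A \<noteq> {x}" "\<And>z. z \<in> A \<Longrightarrow> E x z \<Longrightarrow> z = y"
  shows "conn (A - {x})"
proof (cases "x \<in> A")
  case True
  show ?thesis
    unfolding conn_def
  proof (intro conjI allI impI)
    show "A - {x} \<noteq> {}" using True assms(2) by blast
    fix Y assume Y: "Y \<subseteq> A - {x}" "Y \<noteq> {}" "\<forall>u \<in> Y. \<forall>v \<in> A - {x}. E u v \<longrightarrow> v \<in> Y"
    obtain w where w: "w \<in> Y" using Y(2) by blast
    show "Y = A - {x}"
    proof (cases "y \<in> Y")
      case True
      have "insert x Y = A"
      proof (rule conn_closed_eq[OF assms(1) _ insertI1])
        show "insert x Y \<subseteq> A" using Y(1) \<open>x \<in> A\<close> by blast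
        fix u v assume uv: "u \<in> insert x Y" "v \<in> A" "E u v"
        show "v \<in> insert x Y"
        proof (cases "u = x")
          case True
          then have "v = y" using assms(3) uv by simp
          then show ?thesis using \<open>y \<in> Y\<close> by simp
        next
          case False
          then show ?thesis using Y(3) uv by blast
        qed
      qed
      then show ?thesis using Y(1) by blast
    next
      case False
      have "Y = A"
      proof (rule conn_closed_eq[OF assms(1) _ w])
        show "Y \<subseteq> A" using Y(1) by blast
        fix u v assume uv: "u \<in> Y" "v \<in> A" "E u v"
        have "v \<noteq> x"
        proof
          assume "v = x"
          then have "u = y" using assms(3)[of u] sym[OF uv(3)] uv(1) Y(1) by blast
          then show False using False uv(1) by simp
        qed
        then show "v \<in> Y" using Y(3) uv by blast
      qed
      then show ?thesis using Y(1) True by blast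
    qed
  qed
qed (use assms(1) in simp)

text \<open>This is the Helly property of subtrees; the tree enters through a node \<open>x\<close>
  with at most one neighbour in the given node set. Unless \<open>{x}\<close> is itself a member,
  every member that contains \<open>x\<close> also contains its neighbour \<open>y\<close>. So after
  \<open>x\<close> is deleted from all members they are still connected and still meet
  pairwise.\<close>

lemma helly:
  assumes "finite X"
    and "\<And>Y. Y \<subseteq> X \<Longrightarrow> Y \<noteq> {} \<Longrightarrow> \<exists>x \<in> Y. \<exists>y. \<forall>z \<in> Y. E x z \<longrightarrow> z = y"
    and "F \<noteq> {}" "\<And>A. A \<in> F \<Longrightarrow> conn A" "\<And>A. A \<in> F \<Longrightarrow> A \<subseteq> X"
    and "\<And>A B. A \<in> F \<Longrightarrow> B \<in> F \<Longrightarrow> A \<inter> B \<noteq> {}"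
  shows "\<exists>x \<in> X. \<forall>A \<in> F. x \<in> A"
  using assms
proof (induct X arbitrary: F rule: finite_psubset_induct)
  case (psubset X)
  obtain A0 where A0: "A0 \<in> F" using psubset.prems(2) by blast
  have "X \<noteq> {}" using conn_nonempty[OF psubset.prems(3)[OF A0]] psubset.prems(4)[OF A0] by blast
  then obtain x y where x: "x \<in> X" and y: "\<forall>z \<in> X. E x z \<longrightarrow> z = y" using psubset.prems(1)[of X] by blast
  have y': "z = y" if "A \<in> F" "z \<in> A" "E x z" for A z
    using y psubset.prems(4)[OF that(1)] that(2,3) by blast
  show ?case
  proof (cases "{x} \<in> F")
    case True
    have "x \<in> A" if "A \<in> F" for A using psubset.prems(5)[OF that True] by blast
    with x show ?thesis by blast
  next
    case False
    have yA: "y \<in> A \<and> y \<noteq> x" if A: "A \<in> F" "x \<in> A" for A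
    proof -
      have "A \<noteq> {x}" using A(1) False by blast
      then have "\<exists>u \<in> {x}. \<exists>v \<in> A - {x}. E u v"
        by (intro conn_crossing psubset.prems(3)[OF A(1)]) (use A(2) in auto)
      then show ?thesis using y'[OF A(1)] by auto
    qed
    have "\<exists>z \<in> X - {x}. \<forall>A \<in> (\<lambda>A. A - {x}) ` F. z \<in> A"
    proof (rule psubset.hyps)
      show "X - {x} \<subset> X" using x by blast
      show "\<exists>x \<in> Y. \<exists>y. \<forall>z \<in> Y. E x z \<longrightarrow> z = y" if "Y \<subseteq> X - {x}" "Y \<noteq> {}" for Y
        by (rule psubset.prems(1)) (use that in auto)
      show "(\<lambda>A. A - {x}) ` F \<noteq> {}" using A0 by blast
    next
      fix A assume "A \<in> (\<lambda>A. A - {x}) ` F"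
      then obtain A' where A': "A' \<in> F" "A = A' - {x}" by blast
      show "conn A" unfolding A'(2)
        by (rule conn_remove_leaf[OF psubset.prems(3)[OF A'(1)], of x y]) (use A' False y' in auto)
      show "A \<subseteq> X - {x}" using A' psubset.prems(4) by blast
      fix B assume "B \<in> (\<lambda>A. A - {x}) ` F"
      then obtain B' where B': "B' \<in> F" "B = B' - {x}" by blast
      obtain z where z: "z \<in> A'" "z \<in> B'" using psubset.prems(5)[OF A'(1) B'(1)] by blast
      show "A \<inter> B \<noteq> {}"
      proof (cases "z = x")
        case True
        then have "y \<in> A \<inter> B" using yA[OF A'(1)] yA[OF B'(1)] z A'(2) B'(2) by simp
        then show ?thesis by blast
      next
        case False
        then show ?thesis using z A'(2) B'(2) by blast
      qed
    qed
    then show ?thesis by auto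
  qed
qed

text \<open>A connection in \<open>D'\<close> can enter and leave \<open>U\<close> only through
  \<open>D\<close>. It can be rerouted inside the connected set \<open>D\<close>, which lies in
  \<open>D'\<close> as soon as it meets \<open>D'\<close>.\<close>

lemma conn_remove_closed:
  assumes conn: "conn D" "conn D'" and m: "m \<in> D'" "m \<notin> U"
    and sub: "D \<inter> D' \<noteq> {} \<Longrightarrow> D \<subseteq> D'" "D \<inter> U = {}"
    and U: "\<And>u v. u \<in> U \<Longrightarrow> v \<in> D' \<Longrightarrow> E u v \<Longrightarrow> v \<in> U \<union> D"
  shows "conn (D' - U)"
proof (rule conn_rootI)
  show "m \<in> D' - U" using m by blast
  fix X assume X: "X \<subseteq> D' - U" "m \<in> X" "\<And>u v. u \<in> X \<Longrightarrow> v \<in> D' - U \<Longrightarrow> E u v \<Longrightarrow> v \<in> X"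
  show "D' - U \<subseteq> X"
  proof (cases "D \<inter> X = {}")
    case True
    have "X = D'"
    proof (rule conn_closed_eq[OF conn(2) _ X(2)])
      show "X \<subseteq> D'" using X(1) by blast
      fix u v assume uv: "u \<in> X" "v \<in> D'" "E u v"
      have "v \<notin> U"
      proof
        assume "v \<in> U"
        then have "u \<in> U \<union> D" using U[OF _ _ sym[OF uv(3)]] uv(1) X(1) by blast
        then show False using uv(1) X(1) True by blast
      qed
      then show "v \<in> X" using X(3)[OF uv(1) _ uv(3)] uv(2) by blast
    qed
    then show ?thesis by blast
  next
    case False
    then obtain d where d: "d \<in> D" "d \<in> X" by blast
    have DD': "D \<subseteq> D'" using sub(1) d X(1) by blast
    have "X \<inter> D = D"
      by (rule conn_closed_eq[OF conn(1), of _ d]) (use d X(3) DD' sub(2) in blast)+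
    then have DX: "D \<subseteq> X" by blast
    have "X \<union> (U \<inter> D') = D'"
    proof (rule conn_closed_eq[OF conn(2)])
      show "X \<union> (U \<inter> D') \<subseteq> D'" using X(1) by blast
      show "m \<in> X \<union> (U \<inter> D')" using X(2) by blast
      fix u v assume uv: "u \<in> X \<union> (U \<inter> D')" "v \<in> D'" "E u v"
      show "v \<in> X \<union> (U \<inter> D')"
      proof (cases "v \<in> U")
        case False
        then show ?thesis using X(3)[OF _ _ uv(3)] U[OF _ uv(2,3)] uv(1,2) DX by blast
      qed (use uv(2) in blast)
    qed
    then show ?thesis by blast
  qed
qed

end

text \<open>Acyclicity of the tree is recorded by \<open>leaf\<close>, the form that the Helly
  property consumes. The bound \<open>k\<close> on the bags corresponds to width at most
  \<open>k - 1\<close>.\<close>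

locale tree_bags = symmetric_relation E + tree: symmetric_relation F
  for E :: "'a \<Rightarrow> 'a \<Rightarrow> bool" and F :: "'n \<Rightarrow> 'n \<Rightarrow> bool" +
  fixes N :: "'n set" and B :: "'n \<Rightarrow> 'a set" and V :: "'a set" and k :: nat
  assumes finite_N: "finite N" and finite_V: "finite V"
    and leaf: "Y \<subseteq> N \<Longrightarrow> Y \<noteq> {} \<Longrightarrow> \<exists>x \<in> Y. \<exists>y. \<forall>z \<in> Y. F x z \<longrightarrow> z = y"
    and B_subset: "x \<in> N \<Longrightarrow> B x \<subseteq> V"
    and B_card: "x \<in> N \<Longrightarrow> card (B x) \<le> k"
    and conn_bags: "v \<in> V \<Longrightarrow> tree.conn {x \<in> N. v \<in> B x}"
    and edge_bag: "u \<in> V \<Longrightarrow> v \<in> V \<Longrightarrow> E u v \<Longrightarrow> \<exists>x \<in> N. u \<in> B x \<and> v \<in> B x"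
begin

definition small :: "'a set \<Rightarrow> bool" where
  "small X \<longleftrightarrow> (\<exists>x \<in> N. X \<subseteq> B x)"

text \<open>This adapts the touching of bramble members to bags: subsets of \<open>V\<close> that
  share a vertex or are joined by an edge touch, and two vertices of one bag touch even when they
  are not adjacent.\<close>

definition touch :: "'a set \<Rightarrow> 'a set \<Rightarrow> bool" where
  "touch P Q \<longleftrightarrow> (\<exists>x \<in> N. B x \<inter> P \<noteq> {} \<and> B x \<inter> Q \<noteq> {})"

lemma touch_sym: "touch P Q \<Longrightarrow> touch Q P"
  unfolding touch_def by blast

lemma vertex_bag: "v \<in> V \<Longrightarrow> \<exists>x \<in> N. v \<in> B x"
  using tree.conn_nonempty[OF conn_bags] by blast

lemma small_mono: "small Y \<Longrightarrow> X \<subseteq> Y \<Longrightarrow> small X"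
  unfolding small_def by blast

lemma small_card: "small X \<Longrightarrow> card X \<le> k"
  unfolding small_def using B_card B_subset finite_V by (meson card_mono finite_subset order_trans)

lemma small_singleton: "v \<in> V \<Longrightarrow> small {v}"
  unfolding small_def using vertex_bag by simp

text \<open>A closed set \<open>X\<close> of nodes that contains one node of a vertex of
  \<open>A\<close> contains them all (\<open>cl\<close>), because these nodes are connected. The
  vertices with nodes in \<open>X\<close> are closed in \<open>A\<close>, because adjacent vertices
  share a node; so they are all of \<open>A\<close>.\<close>

lemma conn_nodes:
  assumes "conn A" "A \<subseteq> V"
  shows "tree.conn {x \<in> N. B x \<inter> A \<noteq> {}}"
  unfolding tree.conn_def
proof (intro conjI allI impI)
  let ?T = "{x \<in> N. B x \<inter> A \<noteq> {}}"
  obtain a where a: "a \<in> A" using conn_nonempty[OF assms(1)] by blast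
  then show "?T \<noteq> {}" using vertex_bag assms(2) by blast
  fix X assume X: "X \<subseteq> ?T" "X \<noteq> {}" "\<forall>u \<in> X. \<forall>v \<in> ?T. F u v \<longrightarrow> v \<in> X"
  have cl: "{x \<in> N. v \<in> B x} \<subseteq> X" if v: "v \<in> A" "v \<in> B x" "x \<in> X" for v x
  proof -
    have "X \<inter> {x \<in> N. v \<in> B x} = {x \<in> N. v \<in> B x}"
    proof (rule tree.conn_closed_eq[OF conn_bags])
      show "v \<in> V" using v assms(2) by blast
      show "x \<in> X \<inter> {x \<in> N. v \<in> B x}" using v X(1) by blast
      fix y z assume "y \<in> X \<inter> {x \<in> N. v \<in> B x}" "z \<in> {x \<in> N. v \<in> B x}" "F y z"
      then show "z \<in> X \<inter> {x \<in> N. v \<in> B x}" using X(3) v(1) by blast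
    qed blast
    then show ?thesis by blast
  qed
  obtain x b where xb: "x \<in> X" "b \<in> B x" "b \<in> A" using X(1,2) by blast
  let ?A = "{v \<in> A. \<exists>x \<in> X. v \<in> B x}"
  have "?A = A"
  proof (rule conn_closed_eq[OF assms(1)])
    show "b \<in> ?A" using xb by blast
    fix u v assume uv: "u \<in> ?A" "v \<in> A" "E u v"
    then obtain y where y: "y \<in> N" "u \<in> B y" "v \<in> B y" using edge_bag assms(2) by blast
    obtain z where "z \<in> X" "u \<in> B z" using uv(1) by blast
    then have "y \<in> X" using cl[of u z] uv(1) y by blast
    then show "v \<in> ?A" using y(3) uv(2) by blast
  qed blast
  then show "X = ?T" using X(1) cl by blast
qed

text \<open>Touching says that the node sets meet, and \<open>conn_nodes\<close> makes these node
  sets connected, so the Helly property applies.\<close>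

lemma helly_bag:
  assumes "\<F> \<noteq> {}" "\<And>A. A \<in> \<F> \<Longrightarrow> conn A" "\<And>A. A \<in> \<F> \<Longrightarrow> A \<subseteq> V"
    and "\<And>P Q. P \<in> \<F> \<Longrightarrow> Q \<in> \<F> \<Longrightarrow> touch P Q"
  shows "\<exists>x \<in> N. \<forall>A \<in> \<F>. B x \<inter> A \<noteq> {}"
proof -
  have "\<exists>x \<in> N. \<forall>T \<in> (\<lambda>A. {x \<in> N. B x \<inter> A \<noteq> {}}) ` \<F>. x \<in> T"
  proof (rule tree.helly[OF finite_N leaf])
    show "(\<lambda>A. {x \<in> N. B x \<inter> A \<noteq> {}}) ` \<F> \<noteq> {}" using assms(1) by blast
    fix T assume "T \<in> (\<lambda>A. {x \<in> N. B x \<inter> A \<noteq> {}}) ` \<F>"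
    then obtain P where P: "P \<in> \<F>" "T = {x \<in> N. B x \<inter> P \<noteq> {}}" by blast
    show "tree.conn T" unfolding P(2) by (rule conn_nodes[OF assms(2,3)[OF P(1)]])
    show "T \<subseteq> N" using P(2) by blast
    fix T' assume "T' \<in> (\<lambda>A. {x \<in> N. B x \<inter> A \<noteq> {}}) ` \<F>"
    then obtain Q where Q: "Q \<in> \<F>" "T' = {x \<in> N. B x \<inter> Q \<noteq> {}}" by blast
    show "T \<inter> T' \<noteq> {}" using assms(4)[OF P(1) Q(1)] unfolding touch_def P(2) Q(2) by blast
  qed
  then show ?thesis by auto
qed

text \<open>
  Some bag \<open>X\<close> containing the neighbourhood \<open>S\<close> of \<open>C\<close> is such that no component of \<open>C - X\<close> contains
  all vertices \<open>M\<close> of \<open>C\<close> adjacent to \<open>S\<close>: otherwise the singletons of \<open>S\<close> and those components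
  pairwise share bags, so that by the Helly property one bag meets them all. A smallest separator
  with this property leaves only components with connected complement: if \<open>A - D\<close> is disconnected,
  its part \<open>U\<close> away from \<open>S\<close> can be removed from the separator.
\<close>

lemma separate_bag:
  assumes A: "conn A" "A \<subseteq> V" and C: "C \<subseteq> A" "C \<noteq> A" "conn C" "conn (A - C)" "small (nb A C)"
  shows "\<exists>Z. small Z \<and> nb A C \<subseteq> Z \<and> Z \<subseteq> C \<union> nb A C \<and> Z \<inter> C \<noteq> {} \<and> (\<forall>D \<in> comps (C - Z). conn (A - D))"
proof -
  define S where "S = nb A C"
  define M where "M = {u \<in> C. \<exists>s \<in> S. E u s}"
  define ok where "ok Z \<longleftrightarrow> small Z \<and> S \<subseteq> Z \<and> Z \<subseteq> C \<union> S \<and> (\<forall>D \<in> comps (C - Z). \<not> M \<subseteq> D)" for Z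
  have SA: "S \<subseteq> A - C" unfolding S_def by (rule nb_subset)
  obtain u0 s0 where us0: "u0 \<in> C" "s0 \<in> A - C" "E u0 s0"
    using conn_crossing[OF A(1) C(1) conn_nonempty[OF C(3)] C(2)] by blast
  then have s0: "s0 \<in> S" unfolding S_def nb_def by blast
  then have u0: "u0 \<in> M" unfolding M_def using us0 by blast
  have S_adj: "\<exists>u \<in> M. E u s" if "s \<in> S" for s
    using that unfolding M_def unfolding S_def nb_def by blast
  have MV: "M \<subseteq> V" "S \<subseteq> V" using C(1) A(2) SA unfolding M_def by blast+
  have "\<exists>Z. ok Z"
  proof (rule ccontr)
    assume none: "\<not> (\<exists>Z. ok Z)"
    \<comment> \<open>When the bag is cut down to \<open>C \<union> S\<close>, only the last clause
      of \<open>ok\<close> can fail, and the cut does not change \<open>C - B x\<close>.\<close>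
    have comp: "\<exists>D \<in> comps (C - B x). M \<subseteq> D" if x: "x \<in> N" "S \<subseteq> B x" for x
    proof -
      have "C - B x \<inter> (C \<union> S) = C - B x" by blast
      moreover have "small (B x \<inter> (C \<union> S))" unfolding small_def using x by blast
      moreover have "\<not> ok (B x \<inter> (C \<union> S))" using none by simp
      ultimately show ?thesis unfolding ok_def using x by auto
    qed
    define \<D> where "\<D> = {D. \<exists>x \<in> N. S \<subseteq> B x \<and> D \<in> comps (C - B x) \<and> M \<subseteq> D}"
    have \<D>: "conn D" "D \<subseteq> C" "M \<subseteq> D" if "D \<in> \<D>" for D
      using that comps_conn comps_subset unfolding \<D>_def by blast+
    have t1: "touch {s} {s'}" if "s \<in> S" "s' \<in> S" for s s'
      using C(5) that unfolding small_def touch_def S_def by blast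
    have t2: "touch {s} D" if sD: "s \<in> S" "D \<in> \<D>" for s D
    proof -
      obtain u where u: "u \<in> M" "E u s" using S_adj sD(1) by blast
      then obtain x where "x \<in> N" "u \<in> B x" "s \<in> B x" using edge_bag MV sD(1) by blast
      then show ?thesis unfolding touch_def using u(1) \<D>(3)[OF sD(2)] by blast
    qed
    have t3: "touch D D'" if DD: "D \<in> \<D>" "D' \<in> \<D>" for D D'
    proof -
      obtain x where "x \<in> N" "u0 \<in> B x" using vertex_bag u0 MV by blast
      then show ?thesis unfolding touch_def using u0 \<D>(3)[OF DD(1)] \<D>(3)[OF DD(2)] by blast
    qed
    have "\<exists>x \<in> N. \<forall>P \<in> (\<lambda>s. {s}) ` S \<union> \<D>. B x \<inter> P \<noteq> {}"
    proof (rule helly_bag)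
      show "(\<lambda>s. {s}) ` S \<union> \<D> \<noteq> {}" using s0 by blast
      show "conn P" if "P \<in> (\<lambda>s. {s}) ` S \<union> \<D>" for P
        using that \<D>(1) conn_singleton by blast
      show "P \<subseteq> V" if "P \<in> (\<lambda>s. {s}) ` S \<union> \<D>" for P
        using that \<D>(2) MV(2) C(1) A(2) by blast
      show "touch P Q" if "P \<in> (\<lambda>s. {s}) ` S \<union> \<D>" "Q \<in> (\<lambda>s. {s}) ` S \<union> \<D>" for P Q
        using that t1 t2 t3 touch_sym[OF t2] by (elim UnE imageE) simp_all
    qed
    then obtain x where x: "x \<in> N" "\<forall>P \<in> (\<lambda>s. {s}) ` S \<union> \<D>. B x \<inter> P \<noteq> {}" by (elim bexE) (rule that)
    have "S \<subseteq> B x"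
    proof
      fix s assume "s \<in> S"
      then have "{s} \<in> (\<lambda>s. {s}) ` S \<union> \<D>" by simp
      then show "s \<in> B x" using bspec[OF x(2)] by auto
    qed
    then obtain D where D: "D \<in> comps (C - B x)" "M \<subseteq> D" using comp x(1) by blast
    with x(1) \<open>S \<subseteq> B x\<close> have "D \<in> \<D>" unfolding \<D>_def by auto
    \<comment> \<open>The bag found by \<open>helly_bag\<close> meets every member of the family,
      whereas \<open>D\<close> is a component of \<open>C - B x\<close>.\<close>
    then have "B x \<inter> D \<noteq> {}" using bspec[OF x(2), of D] by simp
    then show False using comps_subset[OF D(1)] by blast
  qed
  then obtain Z where Z: "ok Z" and min: "\<And>Z'. ok Z' \<Longrightarrow> card Z \<le> card Z'"
    using ex_has_least_nat[of ok _ card] by blast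
  have Zs: "small Z" "S \<subseteq> Z" "Z \<subseteq> C \<union> S" and ZM: "\<And>D. D \<in> comps (C - Z) \<Longrightarrow> \<not> M \<subseteq> D"
    using Z unfolding ok_def by blast+
  have finZ: "finite Z" using Zs(3) SA C(1) A(2) finite_V by (meson Diff_subset finite_Un finite_subset)
  \<comment> \<open>If \<open>Z\<close> missed \<open>C\<close>, then \<open>C\<close> would lie in
    a single component, which would contain \<open>M\<close>.\<close>
  have "Z \<inter> C \<noteq> {}"
  proof
    assume "Z \<inter> C = {}"
    then have "C \<subseteq> C - Z" by blast
    then obtain D where "D \<in> comps (C - Z)" "C \<subseteq> D" using conn_in_comps[OF C(3)] by blast
    then show False using ZM unfolding M_def by blast
  qed
  moreover have "conn (A - D)" if D: "D \<in> comps (C - Z)" for D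
  proof (rule ccontr)
    assume nconn: "\<not> conn (A - D)"
    have DC: "D \<subseteq> C - Z" by (rule comps_subset[OF D])
    obtain K where K: "K \<in> comps (A - D)" "A - C \<subseteq> K"
      using conn_in_comps[OF C(4), of "A - D"] DC by blast
    have KA: "K \<subseteq> A - D" by (rule comps_subset[OF K(1)])
    define U where "U = A - D - K"
    have "U \<noteq> {}"
    proof
      assume "U = {}"
      then have "A - D = K" using KA unfolding U_def by blast
      then show False using nconn comps_conn[OF K(1)] by simp
    qed
    have UC: "U \<subseteq> C" unfolding U_def using K(2) by blast
    have UK: "\<not> E u v" if "u \<in> U" "v \<in> K" for u v
    proof
      assume "E u v"
      then have "u \<in> K" using comps_closed[OF K(1) that(2) _ sym[OF \<open>E u v\<close>]] that(1) unfolding U_def by simp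
      then show False using that(1) unfolding U_def by blast
    qed
    have US: "S \<inter> U = {}" using UC SA by blast
    \<comment> \<open>A vertex of \<open>M\<close> has a neighbour in \<open>S\<close>, hence in
      \<open>K\<close>, whereas \<open>U\<close> has no neighbour in \<open>K\<close>.\<close>
    have UM: "U \<inter> M = {}" using UK SA K(2) unfolding M_def by blast
    have UD: "v \<in> U \<union> D" if "u \<in> U" "v \<in> A" "E u v" for u v
      using UK[OF that(1)] that(2,3) unfolding U_def by blast
    have "\<exists>u \<in> U. \<exists>v \<in> A - U. E u v"
    proof (rule conn_crossing[OF A(1) _ \<open>U \<noteq> {}\<close>])
      show "U \<subseteq> A" using UC C(1) by blast
      show "U \<noteq> A" using UC C(1,2) by blast
    qed
    then obtain u v where uv: "u \<in> U" "v \<in> A" "v \<notin> U" "E u v" by blast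
    have "v \<in> D" using UD[OF uv(1,2,4)] uv(3) by blast
    have "u \<in> Z"
    proof (rule ccontr)
      assume "u \<notin> Z"
      then have "u \<in> D" using comps_closed[OF D \<open>v \<in> D\<close> _ sym[OF uv(4)]] UC uv(1) by blast
      then show False using uv(1) unfolding U_def by blast
    qed
    \<comment> \<open>If a component \<open>D'\<close> left by \<open>Z - U\<close> contained
      \<open>M\<close>, then \<open>D' - U\<close> would still be connected and contain
      \<open>M\<close>, but avoid \<open>Z\<close>, against the choice of \<open>Z\<close>.\<close>
    have "ok (Z - U)"
      unfolding ok_def
    proof (intro conjI ballI notI)
      show "small (Z - U)" using small_mono[OF Zs(1)] by blast
      show "S \<subseteq> Z - U" using Zs(2) US by blast
      show "Z - U \<subseteq> C \<union> S" using Zs(3) by blast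
      fix D' assume D': "D' \<in> comps (C - (Z - U))" "M \<subseteq> D'"
      have D'C: "D' \<subseteq> C - (Z - U)" by (rule comps_subset[OF D'(1)])
      have "conn (D' - U)"
      proof (rule conn_remove_closed[OF comps_conn[OF D] comps_conn[OF D'(1)]])
        show "u0 \<in> D'" "u0 \<notin> U" using u0 D'(2) UM by blast+
        show "D \<subseteq> D'" if DD': "D \<inter> D' \<noteq> {}"
        proof -
          obtain d where d: "d \<in> D" "d \<in> D'" using DD' by blast
          show ?thesis
            by (rule conn_subset_comps[OF comps_conn[OF D] _ D'(1) d]) (use DC in blast)
        qed
        show "D \<inter> U = {}" unfolding U_def by blast
        show "v \<in> U \<union> D" if "u \<in> U" "v \<in> D'" "E u v" for u v
          by (rule UD[OF that(1) _ that(3)]) (use that(2) D'C C(1) in blast)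
      qed
      moreover have "D' - U \<subseteq> C - Z" using D'C by blast
      ultimately obtain D'' where D'': "D'' \<in> comps (C - Z)" "D' - U \<subseteq> D''" using conn_in_comps by blast
      have "M \<subseteq> D''" using D'(2) UM D''(2) by blast
      with ZM[OF D''(1)] show False by (rule notE)
    qed
    then have "card Z \<le> card (Z - U)" by (rule min)
    moreover have "Z - U \<subset> Z" using \<open>u \<in> Z\<close> uv(1) by blast
    ultimately show False using psubset_card_mono[OF finZ] by (meson not_less)
  qed
  ultimately show ?thesis using Zs unfolding S_def by blast
qed

end

section \<open>Two-element separators for sets that are not heavy of order 1\<close>

context symmetric_relation begin

text \<open>Distinct neighbours \<open>s\<close> and \<open>s'\<close> would split
  \<open>A - C\<close> into two connected parts, one around each. Both parts are adjacent to
  \<open>C\<close>, so these two and \<open>C\<close> would be three parts with connected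
  complements, making \<open>A\<close> heavy of order 1.\<close>

lemma unique_crossing:
  assumes "conn A" "\<not> heavy (Suc 0) A" "C \<subseteq> A" "conn C" "conn (A - C)"
    and "s \<in> nb A C" "s' \<in> nb A C"
  shows "s = s'"
proof (rule ccontr)
  assume "s \<noteq> s'"
  obtain u u' where u: "u \<in> C" "E u s" "u' \<in> C" "E u' s'" "s \<in> A - C" "s' \<in> A - C"
    using assms(6,7) unfolding nb_def by blast
  obtain P where P: "P \<subseteq> A - C" "conn P" "conn (A - C - P)" "s \<notin> P" "s' \<in> P"
    using conn_split[OF assms(5) u(5,6) \<open>s \<noteq> s'\<close>] by metis
  have "conn (C \<union> (A - C - P))"
    by (rule conn_Un_edge[OF assms(4) P(3) u(1) _ u(2)]) (use u P in blast)
  moreover have "C \<union> (A - C - P) = A - P" using assms(3) P(1) by blast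
  moreover have "conn (C \<union> P)"
    by (rule conn_Un_edge[OF assms(4) P(2) u(3) P(5) u(4)])
  moreover have "C \<union> P = A - (A - C - P)" using assms(3) P(1) by blast
  ultimately have "C \<subseteq> A \<and> P \<subseteq> A \<and> A - C - P \<subseteq> A \<and> C \<inter> P = {} \<and> C \<inter> (A - C - P) = {} \<and> P \<inter> (A - C - P) = {} \<and>
      heavy 0 C \<and> heavy 0 P \<and> heavy 0 (A - C - P) \<and> conn (A - C) \<and> conn (A - P) \<and> conn (A - (A - C - P))"
    using assms(3-5) P(1-3) by (auto simp: Int_Diff)
  then have "heavy (Suc 0) A"
    unfolding heavy.simps(2) by (intro conjI[OF assms(1)]) (rule exI)+
  with assms(2) show False by (rule notE)
qed

text \<open>\<open>C\<close> has a single neighbour \<open>s\<close>, and any edge from some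
  \<open>u\<close> in \<open>C\<close> to \<open>s\<close> gives the separator
  \<open>{u, s}\<close>. For a component \<open>D\<close> of \<open>C - {u}\<close>, the set
  \<open>C - D\<close> is connected, contains \<open>u\<close>, and is joined to
  \<open>A - C\<close> by that edge.\<close>

lemma separate_pair:
  assumes A: "conn A" "\<not> heavy (Suc 0) A" and C: "C \<subseteq> A" "C \<noteq> A" "conn C" "conn (A - C)"
  shows "\<exists>Z. (finite Z \<and> card Z \<le> 2) \<and> nb A C \<subseteq> Z \<and> Z \<subseteq> C \<union> nb A C \<and> Z \<inter> C \<noteq> {} \<and>
    (\<forall>D \<in> comps (C - Z). conn (A - D))"
proof -
  obtain u s where us: "u \<in> C" "s \<in> A - C" "E u s"
    using conn_crossing[OF A(1) C(1) conn_nonempty[OF C(3)] C(2)] by blast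
  have s: "s \<in> nb A C" using us unfolding nb_def by blast
  have S: "nb A C = {s}" using unique_crossing[OF A C(1,3,4) s] s by blast
  have "conn (A - D)" if D: "D \<in> comps (C - {u, s})" for D
  proof -
    have "C - {u, s} = C - {u}" using us by blast
    then have D': "D \<in> comps (C - {u})" using D by simp
    have DC: "D \<subseteq> C - {u}" by (rule comps_subset[OF D'])
    have cD: "conn (C - D)" by (rule conn_minus_comps[OF C(3) conn_singleton _ D']) (use us in blast)
    have "conn ((C - D) \<union> (A - C))"
      by (rule conn_Un_edge[OF cD C(4) _ us(2,3)]) (use us DC in blast)
    moreover have "(C - D) \<union> (A - C) = A - D" using C(1) DC by blast
    ultimately show ?thesis by simp
  qed
  moreover have "card {u, s} \<le> 2" by (simp add: card_insert_if)
  ultimately show ?thesis using us by (intro exI[of _ "{u, s}"]) (simp add: S)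
qed

end

section \<open>Path decompositions of sets that are not heavy\<close>

context tree_bags begin

theorem path_bags_of_not_heavy:
  assumes "conn A" "A \<subseteq> V" "\<not> heavy (Suc h) A"
  shows "\<exists>L. path_bags (k * h + 2) A L"
  using assms
proof (induct h arbitrary: A)
  case 0
  have fA: "finite A" using 0(2) finite_V finite_subset by blast
  \<comment> \<open>Heavy of order 0 means connected, so there are no light components and
    \<open>m = 0\<close> suffices.\<close>
  interpret separators E A "\<lambda>X. finite X \<and> card X \<le> 2" 2 0 0
  proof unfold_locales
    show "conn A" "\<not> heavy (Suc 0) A" "finite A" by fact+
    show "finite X \<and> card X \<le> 2" if "finite Y \<and> card Y \<le> 2" "X \<subseteq> Y" for X Y
      using that card_mono[of Y X] finite_subset[of X Y] by linarith
    show "\<exists>L. path_bags 0 D L" if "conn D" "\<not> heavy 0 D" for D using that by simp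
  qed (use separate_pair[OF 0(1,3)] in simp_all)
  show ?case using path_bags_exists by (simp add: numeral_2_eq_2)
next
  case (Suc h)
  have fA: "finite A" using Suc.prems(2) finite_V finite_subset by blast
  \<comment> \<open>Light components have bags of size \<open>k * h + 2\<close> by the induction
    hypothesis; the separators add \<open>k\<close>, which gives
    \<open>k * Suc h + 2\<close>.\<close>
  interpret separators E A small k "k * h + 2" "Suc h"
  proof unfold_locales
    show "conn A" "\<not> heavy (Suc (Suc h)) A" "finite A" by fact+
    show "small X" if "small Y" "X \<subseteq> Y" for X Y using small_mono that by blast
    show "card X \<le> k" if "small X" for X using small_card that by blast
    show "small {v}" if "v \<in> A" for v using small_singleton that Suc.prems(2) by blast
    show "\<exists>L. path_bags (k * h + 2) D L" if "D \<subseteq> A" "conn D" "\<not> heavy (Suc h) D" for D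
      by (rule Suc.hyps[OF that(2) subset_trans[OF that(1) Suc.prems(2)] that(3)])
  qed (rule separate_bag[OF Suc.prems(1,2)])
  show ?case using path_bags_exists by (simp add: algebra_simps)
qed

end

section \<open>Trees and levels\<close>

lemma (in pair_wf_digraph) awalk_vwalk_arcs:
  assumes "vs \<noteq> []" "set vs \<subseteq> pverts G" "successively (\<lambda>u v. (u, v) \<in> parcs G) vs"
  shows "awalk (hd vs) (vwalk_arcs vs) (last vs)" and "pawalk_verts (hd vs) (vwalk_arcs vs) = vs"
  using assms by (induct vs rule: vwalk_arcs.induct) (auto simp: awalk_simps)

lemma (in pair_wf_digraph) awalk_nth:
  assumes "awalk u p v" "i < length p"
  shows "p ! i = (pawalk_verts u p ! i, pawalk_verts u p ! Suc i)" and "p ! i \<in> parcs G"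
proof -
  show "p ! i \<in> parcs G" using assms by (auto simp: awalk_def)
  show "p ! i = (pawalk_verts u p ! i, pawalk_verts u p ! Suc i)"
    using assms
  proof (induct p arbitrary: u i)
    case (Cons e p)
    have w: "awalk (snd e) p v" using Cons.prems(1) by (simp add: awalk_Cons_iff)
    show ?case
    proof (cases i)
      case 0
      have "pawalk_verts (snd e) p ! 0 = snd e" using w by (cases p) (auto simp: awalk_Cons_iff)
      then show ?thesis using 0 by simp
    next
      case (Suc j)
      then show ?thesis using Cons.hyps[OF w, of j] Cons.prems(2) by simp
    qed
  qed simp
qed

lemma (in pair_wf_digraph) awalk_nth_ends:
  assumes "awalk u p v"
  shows "pawalk_verts u p ! 0 = u" and "pawalk_verts u p ! length p = v"
  using assms by (induct p arbitrary: u) (simp_all add: awalk_simps)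

lemma (in pair_graph) acyclic_leaf:
  assumes "\<not> (\<exists>p. cycle p \<and> length p \<ge> 3)" "Y \<subseteq> pverts G" "Y \<noteq> {}"
  shows "\<exists>x \<in> Y. \<exists>y. \<forall>z \<in> Y. (x, z) \<in> parcs G \<longrightarrow> z = y"
proof (rule ccontr)
  assume "\<not> ?thesis"
  then have no_leaf: "\<forall>x \<in> Y. \<forall>y. \<exists>z \<in> Y. (x, z) \<in> parcs G \<and> z \<noteq> y" by simp
  let ?R = "\<lambda>u v. (u, v) \<in> parcs G"
  \<comment> \<open>The first vertex of a longest path has another neighbour on the path, which closes a cycle.\<close>
  define walk where "walk vs \<longleftrightarrow> vs \<noteq> [] \<and> set vs \<subseteq> Y \<and> distinct vs \<and> successively ?R vs" for vs
  have finY: "finite Y" by (rule finite_subset[OF assms(2) pair_finite_verts])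
  obtain y0 where "y0 \<in> Y" using assms(3) by (meson ex_in_conv)
  then have "walk [y0]" by (simp add: walk_def)
  moreover have "length vs < Suc (card Y)" if "walk vs" for vs
    using that card_mono[OF finY, of "set vs"] by (simp add: walk_def distinct_card)
  ultimately have "\<exists>vs. walk vs \<and> (\<forall>vs'. walk vs' \<longrightarrow> length vs' \<le> length vs)"
    by (intro ex_has_greatest_nat[of walk "[y0]" length "Suc (card Y)"]) (simp_all add: less_imp_le)
  then obtain vs where vs: "walk vs" and max: "\<forall>vs'. walk vs' \<longrightarrow> length vs' \<le> length vs"
    by (elim exE conjE) (rule that)
  define x where "x = hd vs"
  \<comment> \<open>\<open>y\<close> is the successor of \<open>x\<close> on the path. On a
    one-vertex path the default is immaterial, because the neighbour \<open>z\<close> differs from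
    \<open>x\<close> and is shown to lie on the path.\<close>
  define y where "y = (if length vs \<ge> 2 then vs ! 1 else x)"
  have "x \<in> Y" using vs hd_in_set[of vs] unfolding walk_def x_def by (simp add: subset_iff)
  then obtain z where z: "z \<in> Y" "(x, z) \<in> parcs G" "z \<noteq> y" using no_leaf by metis
  have zx: "z \<noteq> x" "(z, x) \<in> parcs G" using z(2) no_loops' arcs_symmetric by auto
  have "z \<in> set vs"
  proof (rule ccontr)
    assume "z \<notin> set vs"
    then have "walk (z # vs)" using vs z zx unfolding walk_def x_def by (simp add: successively_Cons)
    then show False using max[THEN spec, of "z # vs"] by simp
  qed
  then obtain xs ys where split: "vs = xs @ z # ys" by (meson split_list)
  have xs: "xs \<noteq> []" using zx(1) split unfolding x_def by auto
  have "length xs \<ge> 2"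
  proof (rule ccontr)
    assume "\<not> length xs \<ge> 2"
    then have "length xs = 1" using xs by (cases xs) (auto simp: not_le)
    then show False using z(3) split unfolding y_def by (simp add: nth_append)
  qed
  let ?c = "z # xs @ [z]"
  have c: "set ?c \<subseteq> pverts G" "successively ?R ?c"
    using vs split assms(2) zx(2) xs unfolding walk_def x_def
    by (auto simp: successively_append_iff successively_Cons)
  have "awalk z (vwalk_arcs ?c) z" "pawalk_verts z (vwalk_arcs ?c) = ?c"
    using awalk_vwalk_arcs[OF _ c] by simp_all
  moreover have "length (vwalk_arcs ?c) \<ge> 3"
    using \<open>length xs \<ge> 2\<close> vwalk_length_simp[of ?c] unfolding vwalk_length_def by simp
  moreover have "distinct (tl ?c)" using vs split unfolding walk_def by simp
  ultimately have "cycle (vwalk_arcs ?c)"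
    unfolding cycle_def by (intro exI[of _ z]) (metis list.size(3) not_numeral_le_zero)
  with \<open>length (vwalk_arcs ?c) \<ge> 3\<close> assms(1) show False by metis
qed

text \<open>The levels certify a rooted tree arc by arc, which makes gluing trees easy. Absence of
  cycles, paths from the root and children are all read off from \<open>f\<close>.\<close>

locale level_tree = pair_graph +
  fixes r and f :: "'a \<Rightarrow> nat"
  assumes root: "r \<in> pverts G" and level_root: "f r = 0"
    and level_arc: "(u, v) \<in> parcs G \<Longrightarrow> f v = Suc (f u) \<or> f u = Suc (f v)"
    and parent: "v \<in> pverts G \<Longrightarrow> v \<noteq> r \<Longrightarrow> \<exists>u. (u, v) \<in> parcs G \<and> f v = Suc (f u)"
    and parent_unique: "(u, v) \<in> parcs G \<Longrightarrow> (u', v) \<in> parcs G \<Longrightarrow> f v = Suc (f u) \<Longrightarrow> f v = Suc (f u') \<Longrightarrow> u = u'"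
begin

text \<open>
  A walk that never turns back can descend only along edges to parents, so once it ascends, it
  ascends forever.
\<close>

lemma ascending_walk:
  assumes "\<And>i. i < n \<Longrightarrow> (g i, g (Suc i)) \<in> parcs G"
    and "\<And>i. Suc (Suc i) \<le> n \<Longrightarrow> g i \<noteq> g (Suc (Suc i))"
    and "f (g 1) = Suc (f (g 0))" "i \<le> n"
  shows "f (g i) = f (g 0) + i"
  using assms(4)
proof (induct i rule: less_induct)
  case (less i)
  show ?case
  proof (cases i)
    case (Suc j)
    show ?thesis
    proof (cases j)
      case 0
      then show ?thesis using assms(3) Suc by simp
    next
      case (Suc l)
      have i: "i = Suc (Suc l)" using Suc \<open>i = Suc j\<close> by simp
      have l: "f (g l) = f (g 0) + l" "f (g (Suc l)) = f (g 0) + Suc l"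
        using less.hyps[of l] less.hyps[of "Suc l"] less.prems i by simp_all
      have arcs: "(g l, g (Suc l)) \<in> parcs G" "(g (Suc (Suc l)), g (Suc l)) \<in> parcs G"
        using assms(1)[of l] arcs_symmetric[OF assms(1)[of "Suc l"]] less.prems i by simp_all
      have "f (g (Suc l)) \<noteq> Suc (f (g (Suc (Suc l))))"
        using parent_unique[OF arcs] l assms(2)[of l] less.prems i by auto
      then show ?thesis using level_arc[OF arcs(2)] l i by auto
    qed
  qed simp
qed

text \<open>In neither direction can a cycle start by ascending, since by
  \<open>ascending_walk\<close> it would end above its own starting vertex. Hence both neighbours of
  the start on the cycle are its parents and coincide, which length at least 3 excludes.\<close>

lemma no_cycle: "\<not> (\<exists>p. cycle p \<and> length p \<ge> 3)"
proof
  assume "\<exists>p. cycle p \<and> length p \<ge> 3"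
  then obtain p u where p: "awalk u p u" "distinct (tl (pawalk_verts u p))" "length p \<ge> 3"
    unfolding cycle_def by (elim exE conjE) (rule that)
  define n where "n = length p"
  define g where "g = (!) (pawalk_verts u p)"
  have len: "length (pawalk_verts u p) = Suc n" using length_awalk_verts[of u p] unfolding n_def by simp
  have arc: "(g i, g (Suc i)) \<in> parcs G" if "i < n" for i
    using awalk_nth[OF p(1), of i] that unfolding n_def g_def by simp
  have inj: "g i \<noteq> g j" if "0 < i" "i < j" "j \<le> n" for i j
    using p(2) that len nth_eq_iff_index_eq[OF p(2), of "i - 1" "j - 1"] unfolding g_def
    by (auto simp: nth_tl)
  have g0: "g 0 = u" and gn: "g n = u" unfolding g_def n_def using awalk_nth_ends[OF p(1)] by simp_all
  have nb: "g i \<noteq> g (Suc (Suc i))" if "Suc (Suc i) \<le> n" for i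
  proof (cases i)
    case 0
    then show ?thesis using inj[of "Suc (Suc i)" n] g0 gn p(3) unfolding n_def by auto
  next
    case (Suc j)
    then show ?thesis using inj[of i "Suc (Suc i)"] that by simp
  qed
  have n3: "n \<ge> 3" using p(3) unfolding n_def .
  have "f (g 1) \<noteq> Suc (f (g 0))"
  proof
    assume "f (g 1) = Suc (f (g 0))"
    then have "f (g n) = f (g 0) + n" using ascending_walk[of n g n] arc nb by blast
    then show False using g0 gn n3 by simp
  qed
  moreover define g' where "g' i = g (n - i)" for i
  have "f (g' 1) \<noteq> Suc (f (g' 0))"
  proof
    assume "f (g' 1) = Suc (f (g' 0))"
    then have "f (g' n) = f (g' 0) + n"
    proof (rule ascending_walk[of n g' n, rotated 2])
      show "(g' i, g' (Suc i)) \<in> parcs G" if "i < n" for i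
        using arcs_symmetric[OF arc[of "n - Suc i"]] that unfolding g'_def by (simp add: Suc_diff_Suc)
      show "g' i \<noteq> g' (Suc (Suc i))" if i: "Suc (Suc i) \<le> n" for i
      proof -
        obtain m where m: "n = Suc (Suc i) + m" using le_Suc_ex[OF i] by metis
        then have e: "n - i = Suc (Suc m)" "n - Suc (Suc i) = m" and "Suc (Suc m) \<le> n" by simp_all
        show ?thesis unfolding g'_def e by (rule not_sym[OF nb]) fact
      qed
    qed simp
    then show False using g0 gn n3 unfolding g'_def by simp
  qed
  moreover have "(g 0, g 1) \<in> parcs G" using arc[of 0] n3 by simp
  moreover have "(g' 0, g' 1) \<in> parcs G"
    using arcs_symmetric[OF arc[of "n - 1"]] n3 unfolding g'_def by simp
  ultimately have lower: "f (g 0) = Suc (f (g 1))" "f (g' 0) = Suc (f (g' 1))"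
    using level_arc by blast+
  have "g 1 = g (n - 1)"
  proof (rule parent_unique)
    show "(g 1, u) \<in> parcs G" using arcs_symmetric[OF arc[of 0]] n3 g0 by simp
    show "(g (n - 1), u) \<in> parcs G" using arc[of "n - 1"] n3 gn by simp
    show "f u = Suc (f (g 1))" "f u = Suc (f (g (n - 1)))" using lower g0 gn unfolding g'_def by simp_all
  qed
  moreover have "(0::nat) < 1" "1 < n - 1" "n - 1 \<le> n" using n3 by simp_all
  ultimately show False using inj by metis
qed

text \<open>The bound on the levels serves the induction: a vertex of higher level appended to the
  path is new.\<close>

lemma apath_from_root:
  assumes "x \<in> pverts G"
  shows "\<exists>p. apath r p x \<and> (\<forall>w \<in> set (pawalk_verts r p). f w \<le> f x)"
  using assms
proof (induct "f x" arbitrary: x rule: less_induct)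
  case less
  show ?case
  proof (cases "x = r")
    case True
    then show ?thesis using root by (intro exI[of _ "[]"]) (simp add: apath_simps)
  next
    case False
    then obtain u where u: "(u, x) \<in> parcs G" "f x = Suc (f u)" using parent less.prems by blast
    then obtain p where p: "apath r p u" "\<forall>w \<in> set (pawalk_verts r p). f w \<le> f u"
      using less.hyps[of u] in_arcsD1 by auto
    have w: "awalk r (p @ [(u, x)]) x" using p(1) u less.prems by (auto simp: apath_def awalk_simps intro: in_arcsD1)
    have "pawalk_verts r (p @ [(u, x)]) = pawalk_verts r p @ [x]"
      using awalk_verts_append[OF w] by simp
    then show ?thesis using p u w by (intro exI[of _ "p @ [(u, x)]"]) (auto simp: apath_def)
  qed
qed

text \<open>The root has level 0, so the first arc ascends. A path never turns back, so
  \<open>ascending_walk\<close> fixes the remaining levels.\<close>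

lemma apath_level:
  assumes "apath r p x" "i \<le> length p"
  shows "f (pawalk_verts r p ! i) = i"
proof -
  have p: "awalk r p x" "distinct (pawalk_verts r p)" using assms(1) by (simp_all add: apath_def)
  have len: "length (pawalk_verts r p) = Suc (length p)" using length_awalk_verts[of r p] by simp
  have g0: "pawalk_verts r p ! 0 = r" by (rule awalk_nth_ends(1)[OF p(1)])
  show ?thesis
  proof (cases "p = []")
    case False
    have arc: "(pawalk_verts r p ! i, pawalk_verts r p ! Suc i) \<in> parcs G" if "i < length p" for i
      using awalk_nth[OF p(1) that] by simp
    have "f (pawalk_verts r p ! i) = f (pawalk_verts r p ! 0) + i"
    proof (rule ascending_walk[where g = "(!) (pawalk_verts r p)" and n = "length p", OF arc _ _ assms(2)])
      show "pawalk_verts r p ! i \<noteq> pawalk_verts r p ! Suc (Suc i)" if "Suc (Suc i) \<le> length p" for i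
        using nth_eq_iff_index_eq[OF p(2), of i "Suc (Suc i)"] that len by simp
      show "f (pawalk_verts r p ! 1) = Suc (f (pawalk_verts r p ! 0))"
        using level_arc[OF arc[of 0]] False g0 level_root by simp
    qed
    then show ?thesis using g0 level_root by simp
  qed (use assms(2) level_root in simp)
qed

lemma apath_length:
  assumes "apath r p x"
  shows "length p = f x"
proof -
  have "awalk r p x" using assms by (simp add: apath_def)
  then have "pawalk_verts r p ! length p = x" by (rule awalk_nth_ends(2))
  then show ?thesis using apath_level[OF assms, of "length p"] by simp
qed

text \<open>Path lengths from the root equal levels. Conversely, the path to \<open>x\<close> from
  \<open>apath_from_root\<close> has no vertex above level \<open>f x\<close>, so it can be extended
  by \<open>y\<close>.\<close>

lemma children_eq: "x \<in> pverts G \<Longrightarrow> children G r x = {y. (x, y) \<in> parcs G \<and> f y = Suc (f x)}"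
proof (intro set_eqI iffI)
  fix y assume "y \<in> children G r x"
  then obtain p where p: "apath r (p @ [(x, y)]) y" unfolding children_def by blast
  then have a: "(x, y) \<in> parcs G" "apath r p x"
    by (auto simp: apath_append_iff apath_simps)
  then have "f y = Suc (f x)" using apath_length[OF p] apath_length[OF a(2)] by simp
  with a show "y \<in> {y. (x, y) \<in> parcs G \<and> f y = Suc (f x)}" by simp
next
  fix y assume x: "x \<in> pverts G" and y: "y \<in> {y. (x, y) \<in> parcs G \<and> f y = Suc (f x)}"
  obtain p where p: "apath r p x" "\<forall>w \<in> set (pawalk_verts r p). f w \<le> f x" using apath_from_root[OF x] by blast
  have w: "awalk r (p @ [(x, y)]) y" using p(1) y by (auto simp: apath_def awalk_simps intro: in_arcsD1 in_arcsD2)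
  have "pawalk_verts r (p @ [(x, y)]) = pawalk_verts r p @ [y]"
    using awalk_verts_append[OF w] by simp
  then have "apath r (p @ [(x, y)]) y" using p y w by (auto simp: apath_def)
  then show "y \<in> children G r x" unfolding children_def by blast
qed

lemma undirected_tree: "undirected_tree (with_proj G)"
proof -
  have mk: "mk_symmetric (with_proj G) = G"
    using arcs_symmetric by (auto simp: mk_symmetric_def intro!: pair_pre_digraph.equality)
  have reach: "r \<rightarrow>\<^sup>*\<^bsub>with_proj G\<^esub> x" if "x \<in> pverts G" for x
    using apath_from_root[OF that] reachable_awalkI unfolding apath_def by blast
  have "strongly_connected (with_proj G)"
    unfolding strongly_connected_def
  proof (intro conjI ballI)
    show "verts (with_proj G) \<noteq> {}" using root by auto
    fix u v assume "u \<in> verts (with_proj G)" "v \<in> verts (with_proj G)"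
    then have "r \<rightarrow>\<^sup>*\<^bsub>with_proj G\<^esub> u" "r \<rightarrow>\<^sup>*\<^bsub>with_proj G\<^esub> v" using reach by auto
    then show "u \<rightarrow>\<^sup>*\<^bsub>with_proj G\<^esub> v" using symmetric_reachable[OF sym_arcs] reachable_trans by blast
  qed
  then have "connected (with_proj G)" unfolding connected_def mk .
  then show ?thesis using no_cycle pair_graphD_graph unfolding undirected_tree_def by blast
qed

end

lemma (in level_tree) complete_binary_tree:
  assumes "\<And>x. x \<in> pverts G \<Longrightarrow>
      card {y. (x, y) \<in> parcs G \<and> f y = Suc (f x)} = 2 \<or> {y. (x, y) \<in> parcs G \<and> f y = Suc (f x)} = {} \<and> f x = h"
  shows "complete_binary_tree h G"
  unfolding complete_binary_tree_def
proof (intro conjI bexI[OF _ root] ballI impI allI undirected_tree)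
  show "card (children G r x) = 2" if "x \<in> pverts G" "children G r x \<noteq> {}" for x
    using assms[OF that(1)] that(2) children_eq[OF that(1)] by auto
  show "length p = h" if p: "apath r p x \<and> children G r x = {}" for x p
  proof -
    have x: "x \<in> pverts G" using p unfolding apath_def by (meson awalk_last_in_verts)
    have "{y. (x, y) \<in> parcs G \<and> f y = Suc (f x)} = {}" using p children_eq[OF x] by simp
    then have "f x = h" using assms[OF x] by (metis card.empty zero_neq_numeral)
    then show ?thesis using apath_length[OF conjunct1[OF p]] by simp
  qed
qed

section \<open>Translation between bags and decompositions of graphs\<close>

lemma with_proj_induce_subgraph:
  "with_proj G \<restriction> S = with_proj \<lparr>pverts = S, parcs = {e \<in> parcs G. fst e \<in> S \<and> snd e \<in> S}\<rparr>"
  by (simp add: induce_subgraph_def with_proj_def)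

text \<open>Arbitrary node sets \<open>S\<close> are allowed, so that induced subgraphs are again of
  this form.\<close>

definition nat_path :: "nat set \<Rightarrow> nat pair_pre_digraph" where
  "nat_path S = \<lparr>pverts = S, parcs = {(i, j). i \<in> S \<and> j \<in> S \<and> (j = Suc i \<or> i = Suc j)}\<rparr>"

lemma pair_graph_nat_path:
  assumes "finite S"
  shows "pair_graph (nat_path S)"
proof
  have "parcs (nat_path S) \<subseteq> S \<times> S" by (auto simp: nat_path_def)
  then show "finite (parcs (nat_path S))" using assms finite_subset by blast
qed (use assms in \<open>auto simp: nat_path_def symmetric_def sym_def\<close>)

lemma level_tree_nat_path:
  assumes "a \<le> b"
  shows "level_tree (nat_path {a..b}) a (\<lambda>i. i - a)"
proof (intro level_tree.intro pair_graph_nat_path level_tree_axioms.intro)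
  fix v assume "v \<in> pverts (nat_path {a..b})" "v \<noteq> a"
  then show "\<exists>u. (u, v) \<in> parcs (nat_path {a..b}) \<and> v - a = Suc (u - a)"
    by (intro exI[of _ "v - 1"]) (auto simp: nat_path_def)
qed (use assms in \<open>auto simp: nat_path_def\<close>)

lemma set_vwalk_arcs_upt: "set (vwalk_arcs [a..<b]) = {(i, Suc i) | i. a \<le> i \<and> Suc i < b}"
proof (induct "b - a" arbitrary: a)
  case (Suc n)
  have ab: "a < b" using Suc.hyps(2) by simp
  show ?case
  proof (cases "Suc a < b")
    case True
    have "[a..<b] = a # Suc a # [Suc (Suc a)..<b]" "[Suc a..<b] = Suc a # [Suc (Suc a)..<b]"
      using True ab by (simp_all add: upt_conv_Cons)
    then have "set (vwalk_arcs [a..<b]) = insert (a, Suc a) (set (vwalk_arcs [Suc a..<b]))" by simp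
    also have "\<dots> = insert (a, Suc a) {(i, Suc i) | i. Suc a \<le> i \<and> Suc i < b}"
      using Suc.hyps(1)[of "Suc a"] Suc.hyps(2) by simp
    also have "\<dots> = {(i, Suc i) | i. a \<le> i \<and> Suc i < b}"
      using True by (auto simp: Suc_le_eq order_le_less)
    finally show ?thesis .
  next
    case False
    then have "[a..<b] = [a]" using ab by (simp add: upt_conv_Cons)
    then show ?thesis using False by auto
  qed
qed simp

lemma path_graph_nat_path:
  assumes "n > 0"
  shows "path_graph (nat_path {..<n})"
  unfolding path_graph_def
proof (intro exI conjI)
  show "[0..<n] \<noteq> []" "distinct [0..<n]" "pverts (nat_path {..<n}) = set [0..<n]"
    using assms by (auto simp: nat_path_def)
  show "parcs (nat_path {..<n}) = set (vwalk_arcs [0..<n]) \<union> (set (vwalk_arcs [0..<n]))\<inverse>"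
    unfolding set_vwalk_arcs_upt by (auto simp: nat_path_def)
qed

lemma symmetric_relation_parcs: "pair_graph G \<Longrightarrow> symmetric_relation (\<lambda>u v. (u, v) \<in> parcs G)"
  by (simp add: symmetric_relation_def pair_graph_def pair_pseudo_graph_def pair_sym_digraph.arcs_symmetric)

text \<open>The nodes are the positions in the list. By \<open>interval_list_nth\<close> the
  positions of the bags containing \<open>v\<close> form an interval, which induces a path and hence
  a tree.\<close>

lemma path_bags_imp_path_decomposition:
  assumes G: "pair_graph G"
    and L: "symmetric_relation.path_bags (\<lambda>u v. (u, v) \<in> parcs G) k (pverts G) L" "L \<noteq> []"
  shows "path_decomposition G (nat_path {..<length L}) ((!) L)"
    and "decomposition_width (nat_path {..<length L}) ((!) L) \<le> int k - 1"
proof -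
  interpret pair_graph G by (rule G)
  interpret symmetric_relation "\<lambda>u v. (u, v) \<in> parcs G" by (rule symmetric_relation_parcs[OF G])
  let ?P = "nat_path {..<length L}"
  have un: "\<Union>(set L) = pverts G" and int: "interval_list L" and card: "\<forall>X \<in> set L. card X \<le> k"
    and edges: "\<forall>u \<in> pverts G. \<forall>v \<in> pverts G. (u, v) \<in> parcs G \<longrightarrow> (\<exists>X \<in> set L. u \<in> X \<and> v \<in> X)"
    using L(1) unfolding path_bags_def by simp_all
  have V: "pverts ?P = {..<length L}" by (simp add: nat_path_def)
  have sub: "L ! i \<subseteq> pverts G" if "i < length L" for i
    using un nth_mem[OF that] by auto
  have tree: "undirected_tree (with_proj ?P \<restriction> {i \<in> pverts ?P. v \<in> L ! i})" if v: "v \<in> pverts G" for v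
  proof -
    let ?S = "{i \<in> pverts ?P. v \<in> L ! i}"
    have "v \<in> \<Union>(set L)" using v un by simp
    then obtain i where "i < length L" "v \<in> L ! i" by (auto simp: in_set_conv_nth)
    then have ne: "?S \<noteq> {}" "finite ?S" using V by auto
    have eq: "?S = {Min ?S..Max ?S}"
    proof (intro equalityI subsetI)
      show "j \<in> {Min ?S..Max ?S}" if "j \<in> ?S" for j using that ne(2) by simp
      fix j assume j: "j \<in> {Min ?S..Max ?S}"
      have m: "Min ?S \<in> ?S" "Max ?S \<in> ?S" using ne Min_in Max_in by blast+
      then have "v \<in> L ! j"
        using interval_list_nth[OF int, of "Min ?S" j "Max ?S" v] j V by simp
      then show "j \<in> ?S" using j m(2) V by simp
    qed
    have "with_proj ?P \<restriction> ?S = with_proj (nat_path ?S)"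
      unfolding with_proj_induce_subgraph nat_path_def by (rule arg_cong[where f = with_proj]) auto
    moreover have "undirected_tree (with_proj (nat_path {Min ?S..Max ?S}))"
      by (rule level_tree.undirected_tree[OF level_tree_nat_path]) (rule Min_le[OF ne(2) Max_in[OF ne(2,1)]])
    ultimately show ?thesis unfolding eq[symmetric] by simp
  qed
  have "undirected_tree (with_proj ?P)"
  proof -
    have "{..<length L} = {0..length L - 1}" using L(2) by (cases L) auto
    then show ?thesis using level_tree.undirected_tree[OF level_tree_nat_path[of 0 "length L - 1"]] by simp
  qed
  moreover have bag: "\<exists>x \<in> pverts ?P. u \<in> L ! x \<and> v \<in> L ! x" if uv: "(u, v) \<in> parcs G" for u v
  proof -
    have "\<exists>X \<in> set L. u \<in> X \<and> v \<in> X" using edges uv in_arcsD1[OF uv] in_arcsD2[OF uv] by simp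
    then show ?thesis unfolding V by (auto simp: in_set_conv_nth)
  qed
  ultimately show "path_decomposition G ?P ((!) L)"
    unfolding path_decomposition_def tree_decomposition_def
    using path_graph_nat_path L(2) tree sub V by auto
  have "Max ((\<lambda>x. card (L ! x)) ` pverts ?P) \<le> k"
    using L(2) card by (subst Max_le_iff) (auto simp: V)
  then show "decomposition_width ?P ((!) L) \<le> int k - 1" unfolding decomposition_width_def by simp
qed

lemma connected_induced_conn:
  assumes T: "pair_graph T" and c: "connected (with_proj T \<restriction> S)"
  shows "symmetric_relation.conn (\<lambda>u v. (u, v) \<in> parcs T) S"
proof -
  interpret pair_graph T by (rule T)
  interpret symmetric_relation "\<lambda>u v. (u, v) \<in> parcs T" by (rule symmetric_relation_parcs[OF T])
  let ?M = "mk_symmetric (with_proj T \<restriction> S)"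
  have V: "pverts ?M = S" by (simp add: mk_symmetric_def)
  have arcs: "parcs ?M \<subseteq> parcs T" using arcs_symmetric by (auto simp: mk_symmetric_def)
  have sc: "S \<noteq> {}" "\<forall>u \<in> S. \<forall>v \<in> S. u \<rightarrow>\<^sup>*\<^bsub>with_proj ?M\<^esub> v"
    using c V unfolding connected_def strongly_connected_def by simp_all
  obtain a where a: "a \<in> S" using sc(1) by (meson ex_in_conv)
  show ?thesis
  proof (rule conn_rootI[OF a])
    fix X assume X: "X \<subseteq> S" "a \<in> X" "\<And>u v. u \<in> X \<Longrightarrow> v \<in> S \<Longrightarrow> (u, v) \<in> parcs T \<Longrightarrow> v \<in> X"
    show "S \<subseteq> X"
    proof
      fix v assume "v \<in> S"
      then have "(a, v) \<in> rtrancl_on S (parcs ?M)" using sc(2) a V by (simp add: reachable_def)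
      then show "v \<in> X"
      proof (induct rule: rtrancl_on_induct)
        case (step y z)
        then show ?case using X(3)[of y z] arcs by auto
      qed (rule X(2))
    qed
  qed
qed

lemma tree_decomposition_tree_bags:
  assumes G: "pair_graph G" and T: "tree_decomposition G T B" "decomposition_width T B = int k - 1"
  shows "tree_bags (\<lambda>u v. (u, v) \<in> parcs G) (\<lambda>x y. (x, y) \<in> parcs T) (pverts T) B (pverts G) k"
proof -
  have tree: "undirected_tree (with_proj T)" and sub: "\<forall>x \<in> pverts T. B x \<subseteq> pverts G"
    and trees: "\<forall>v \<in> pverts G. undirected_tree (with_proj T \<restriction> {x \<in> pverts T. v \<in> B x})"
    and edges: "\<forall>(u, v) \<in> parcs G. \<exists>x \<in> pverts T. u \<in> B x \<and> v \<in> B x"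
    using T(1) unfolding tree_decomposition_def by simp_all
  have gT: "pair_graph T" using tree unfolding undirected_tree_def by (intro pair_graphI_graph) simp
  have acyc: "\<not> (\<exists>p. pre_digraph.cycle (with_proj T) p \<and> length p \<ge> 3)" using tree unfolding undirected_tree_def by simp
  have finT: "finite (pverts T)" using gT by (simp add: pair_graph_def pair_digraph_def pair_fin_digraph.pair_finite_verts)
  interpret G: symmetric_relation "\<lambda>u v. (u, v) \<in> parcs G" by (rule symmetric_relation_parcs[OF G])
  interpret T: symmetric_relation "\<lambda>u v. (u, v) \<in> parcs T" by (rule symmetric_relation_parcs[OF gT])
  show ?thesis
  proof unfold_locales
    show "finite (pverts T)" by (rule finT)
    show "finite (pverts G)" using G by (simp add: pair_graph_def pair_digraph_def pair_fin_digraph.pair_finite_verts)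
    show "\<exists>x \<in> Y. \<exists>y. \<forall>z \<in> Y. (x, z) \<in> parcs T \<longrightarrow> z = y" if "Y \<subseteq> pverts T" "Y \<noteq> {}" for Y
      by (rule pair_graph.acyclic_leaf[OF gT acyc that])
    show "B x \<subseteq> pverts G" if "x \<in> pverts T" for x using sub that by simp
    show "card (B x) \<le> k" if "x \<in> pverts T" for x
    proof -
      have "card (B x) \<le> Max ((\<lambda>x. card (B x)) ` pverts T)" using that finT by simp
      then show ?thesis using T(2) unfolding decomposition_width_def by simp
    qed
    show "T.conn {x \<in> pverts T. v \<in> B x}" if "v \<in> pverts G" for v
      by (rule connected_induced_conn[OF gT]) (use trees that in \<open>simp add: undirected_tree_def\<close>)
    show "\<exists>x \<in> pverts T. u \<in> B x \<and> v \<in> B x" if "(u, v) \<in> parcs G" for u v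
      using edges that by auto
  qed
qed

section \<open>Subdivided binary trees in heavy sets\<close>

context symmetric_relation begin

text \<open>Only the vertices of a subdivided binary tree with a stem from \<open>r\<close> are
  recorded. When \<open>fork\<close> joins two trees, their stems become parts of the two subdivided
  edges at the new root \<open>s\<close>.\<close>

inductive branch :: "nat \<Rightarrow> 'a \<Rightarrow> 'a set \<Rightarrow> bool" where
  leaf: "branch 0 r {r}"
| stem: "branch h r W \<Longrightarrow> E s r \<Longrightarrow> s \<notin> W \<Longrightarrow> branch h s (insert s W)"
| fork: "branch h r W \<Longrightarrow> branch h r' W' \<Longrightarrow> W \<inter> W' = {} \<Longrightarrow> E s r \<Longrightarrow> E s r' \<Longrightarrow> s \<notin> W \<union> W' \<Longrightarrow>
    branch (Suc h) s (insert s (W \<union> W'))"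

lemma comps_remove_adjacent:
  assumes "conn K" "r \<in> K" "D \<in> comps (K - {r})"
  shows "\<exists>s \<in> D. E r s"
  using comps_adjacent[OF assms(1,3)] assms(2) sym by auto

lemma comps_remove_card:
  assumes "finite K" "r \<in> K" "D \<in> comps (K - {r})"
  shows "card D < card K" "finite D" "r \<notin> D" "D \<subseteq> K"
proof -
  have D: "D \<subseteq> K - {r}" by (rule comps_subset[OF assms(3)])
  then show "r \<notin> D" "D \<subseteq> K" by blast+
  then show "finite D" using assms(1) by (simp add: finite_subset)
  have "D \<subset> K" using D assms(2) by blast
  then show "card D < card K" by (rule psubset_card_mono[OF assms(1)])
qed

text \<open>The stem is prolonged from \<open>x\<close> to \<open>r\<close> through
  \<open>K\<close>, by recursion on the component of \<open>x\<close> in \<open>K - {r}\<close>. The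
  condition on \<open>K \<inter> W\<close> keeps the added vertices new.\<close>

lemma branch_extend:
  assumes "finite K" "conn K" "x \<in> K" "r \<in> K" "branch h x W" "K \<inter> W \<subseteq> {x}"
  shows "\<exists>W'. W' \<subseteq> K \<union> W \<and> branch h r W'"
  using assms
proof (induct "card K" arbitrary: K r rule: less_induct)
  case less
  show ?case
  proof (cases "r = x")
    case False
    obtain D where D: "D \<in> comps (K - {r})" "x \<in> D" using comps_ex[of x "K - {r}"] less.prems(3) False by auto
    obtain s where s: "s \<in> D" "E r s" using comps_remove_adjacent[OF less.prems(2,4) D(1)] by metis
    note card = comps_remove_card[OF less.prems(1,4) D(1)]
    have "D \<inter> W \<subseteq> {x}" using less.prems(6) card(4) by blast
    then obtain W' where W': "W' \<subseteq> D \<union> W" "branch h s W'"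
      using less.hyps[OF card(1,2) comps_conn[OF D(1)] D(2) s(1) less.prems(5)] by metis
    have "r \<notin> W'" using W'(1) card(3) less.prems(4,6) False by blast
    then have "branch h r (insert r W')" by (rule branch.stem[OF W'(2) s(2)])
    then show ?thesis using W'(1) card(4) less.prems(4) by (intro exI[of _ "insert r W'"]) blast
  qed (use less.prems in blast)
qed

definition full :: "nat \<Rightarrow> 'a set \<Rightarrow> bool" where
  "full h P \<longleftrightarrow> (\<forall>x \<in> P. \<exists>W. W \<subseteq> P \<and> branch h x W)"

text \<open>\<open>D\<close> is the component of \<open>K - {r}\<close> through which the branch
  reaches \<open>P\<close>; the value \<open>{}\<close> stands for an edge from \<open>r\<close>
  directly into \<open>P\<close>. Two branches can thus be kept disjoint by comparing their
  components.\<close>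

lemma branch_towards:
  assumes K: "finite K" "conn K" "r \<in> K" and P: "full h P" "K \<inter> P = {}" "\<exists>u \<in> K. \<exists>v \<in> P. E u v"
  shows "\<exists>s W D. E r s \<and> branch h s W \<and> W \<subseteq> D \<union> P \<and>
    (D = {} \<or> D \<in> comps (K - {r}) \<and> (\<exists>u \<in> D. \<exists>v \<in> P. E u v))"
proof -
  obtain u v where uv: "u \<in> K" "v \<in> P" "E u v" using P(3) by metis
  obtain W where W: "W \<subseteq> P" "branch h v W" using P(1) uv(2) unfolding full_def by metis
  show ?thesis
  proof (cases "u = r")
    case True
    then show ?thesis using W uv(3) by (intro exI[of _ v] exI[of _ W] exI[of _ "{}"]) simp
  next
    case False
    obtain D where D: "D \<in> comps (K - {r})" "u \<in> D" using comps_ex[of u "K - {r}"] uv(1) False by auto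
    obtain s where s: "s \<in> D" "E r s" using comps_remove_adjacent[OF K(2,3) D(1)] by metis
    note card = comps_remove_card[OF K(1,3) D(1)]
    have "u \<notin> W" using W(1) uv(1) P(2) by blast
    then have b: "branch h u (insert u W)" by (rule branch.stem[OF W(2) uv(3)])
    have "D \<inter> insert u W \<subseteq> {u}" using card(4) W(1) P(2) by blast
    then obtain W' where W': "W' \<subseteq> D \<union> insert u W" "branch h s W'"
      using branch_extend[OF card(2) comps_conn[OF D(1)] D(2) s(1) b] by metis
    have "W' \<subseteq> D \<union> P" using W'(1) W(1) D(2) by blast
    moreover have "\<exists>u \<in> D. \<exists>v \<in> P. E u v" using D(2) uv(2,3) by metis
    ultimately show ?thesis using s(2) W'(2) D(1) by metis
  qed
qed

text \<open>If a component of \<open>K - {r}\<close> is adjacent to both \<open>P\<close> and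
  \<open>Q\<close>, the stem moves on into it. Otherwise \<open>r\<close> becomes the fork: the
  branches towards \<open>P\<close> and \<open>Q\<close> use different components, or none, and are
  therefore disjoint.\<close>

lemma branch_join:
  assumes "finite K" "conn K" "r \<in> K" "full h P" "full h Q"
    and "K \<inter> P = {}" "K \<inter> Q = {}" "P \<inter> Q = {}"
    and "\<exists>u \<in> K. \<exists>v \<in> P. E u v" "\<exists>u \<in> K. \<exists>v \<in> Q. E u v"
  shows "\<exists>W. W \<subseteq> K \<union> P \<union> Q \<and> branch (Suc h) r W"
  using assms(1-3,6,7,9,10)
proof (induct "card K" arbitrary: K r rule: less_induct)
  case less
  show ?case
  proof (cases "\<exists>D \<in> comps (K - {r}). (\<exists>u \<in> D. \<exists>v \<in> P. E u v) \<and> (\<exists>u \<in> D. \<exists>v \<in> Q. E u v)")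
    case True
    then obtain D where D: "D \<in> comps (K - {r})" "\<exists>u \<in> D. \<exists>v \<in> P. E u v" "\<exists>u \<in> D. \<exists>v \<in> Q. E u v" by metis
    obtain s where s: "s \<in> D" "E r s" using comps_remove_adjacent[OF less.prems(2,3) D(1)] by metis
    note card = comps_remove_card[OF less.prems(1,3) D(1)]
    have "D \<inter> P = {}" "D \<inter> Q = {}" using card(4) less.prems(4,5) by blast+
    then obtain W where W: "W \<subseteq> D \<union> P \<union> Q" "branch (Suc h) s W"
      using less.hyps[OF card(1,2) comps_conn[OF D(1)] s(1) _ _ D(2,3)] by metis
    have "r \<notin> W" using W(1) card(3) less.prems(3-5) by blast
    then have "branch (Suc h) r (insert r W)" by (rule branch.stem[OF W(2) s(2)])
    then show ?thesis using W(1) card(4) less.prems(3) by (intro exI[of _ "insert r W"]) blast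
  next
    case False
    obtain s W D where s: "E r s" "branch h s W" "W \<subseteq> D \<union> P"
        "D = {} \<or> D \<in> comps (K - {r}) \<and> (\<exists>u \<in> D. \<exists>v \<in> P. E u v)"
      using branch_towards[OF less.prems(1-3) assms(4) less.prems(4,6)] by metis
    obtain s' W' D' where s': "E r s'" "branch h s' W'" "W' \<subseteq> D' \<union> Q"
        "D' = {} \<or> D' \<in> comps (K - {r}) \<and> (\<exists>u \<in> D'. \<exists>v \<in> Q. E u v)"
      using branch_towards[OF less.prems(1-3) assms(5) less.prems(5,7)] by metis
    have "D \<noteq> D' \<or> D = {}" using False s(4) s'(4) by metis
    then have DD': "D \<inter> D' = {}" using s(4) s'(4) comps_disjoint by (metis Int_empty_left Int_empty_right)
    have DK: "D \<subseteq> K - {r}" "D' \<subseteq> K - {r}" using s(4) s'(4) comps_subset by (metis empty_subsetI)+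
    have "W \<inter> W' = {}" using s(3) s'(3) DD' DK less.prems(4,5) assms(8) by blast
    moreover have "r \<notin> W \<union> W'" using s(3) s'(3) DK less.prems(3-5) by blast
    ultimately have "branch (Suc h) r (insert r (W \<union> W'))"
      using branch.fork[OF s(2) s'(2) _ s(1) s'(1)] by simp
    then show ?thesis using s(3) s'(3) DK less.prems(3) by (intro exI[of _ "insert r (W \<union> W')"]) blast
  qed
qed

text \<open>The vertex \<open>r\<close> lies in at most one of the three parts, so two of them, say
  \<open>P\<close> and \<open>Q\<close>, avoid it. The component \<open>K\<close> of
  \<open>r\<close> in \<open>A - P - Q\<close> is adjacent to \<open>P\<close> because
  \<open>A - Q\<close> is connected, and to \<open>Q\<close> because \<open>A - P\<close> is, so
  \<open>branch_join\<close> applies.\<close>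

lemma heavy_full:
  assumes "heavy h A" "finite A"
  shows "full h A"
  using assms
proof (induct h arbitrary: A)
  case 0
  then show ?case unfolding full_def using branch.leaf by blast
next
  case (Suc h)
  have step: "\<exists>W. W \<subseteq> A \<and> branch (Suc h) r W"
    if P: "P \<subseteq> A" "heavy h P" "conn (A - P)" and Q: "Q \<subseteq> A" "heavy h Q" "conn (A - Q)"
      and PQ: "P \<inter> Q = {}" and r: "r \<in> A" "r \<notin> P" "r \<notin> Q" for P Q r
  proof -
    obtain K where K: "K \<in> comps (A - P - Q)" "r \<in> K" using comps_ex[of r "A - P - Q"] r by auto
    have KA: "K \<subseteq> A - P - Q" by (rule comps_subset[OF K(1)])
    have K': "K \<in> comps (A - Q - P)" using K(1) by (simp add: Diff_eq Int_ac)
    have fin: "finite P" "finite Q" "finite K" using Suc.prems(2) P(1) Q(1) KA by (auto intro: finite_subset)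
    have ne: "P \<noteq> {}" "Q \<noteq> {}" using conn_nonempty[OF heavy_conn] P(2) Q(2) by blast+
    have ad: "\<exists>u \<in> K. \<exists>v \<in> P. E u v" "\<exists>u \<in> K. \<exists>v \<in> Q. E u v"
      using comps_adjacent[OF Q(3) K'] comps_adjacent[OF P(3) K(1)] ne P(1) Q(1) PQ by blast+
    have "\<exists>W. W \<subseteq> K \<union> P \<union> Q \<and> branch (Suc h) r W"
      by (rule branch_join[OF fin(3) comps_conn[OF K(1)] K(2) Suc.hyps[OF P(2) fin(1)] Suc.hyps[OF Q(2) fin(2)] _ _ PQ ad])
        (use KA in blast)+
    then show ?thesis using KA P(1) Q(1) by blast
  qed
  obtain P Q R where PQR: "P \<subseteq> A" "Q \<subseteq> A" "R \<subseteq> A" "P \<inter> Q = {}" "P \<inter> R = {}" "Q \<inter> R = {}"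
      "heavy h P" "heavy h Q" "heavy h R" "conn (A - P)" "conn (A - Q)" "conn (A - R)"
    using Suc.prems(1) unfolding heavy.simps by (elim exE conjE) (rule that)
  show ?case
    unfolding full_def
  proof
    fix r assume r: "r \<in> A"
    consider "r \<notin> P" "r \<notin> Q" | "r \<notin> P" "r \<notin> R" | "r \<notin> Q" "r \<notin> R"
      using PQR(4-6) by blast
    then show "\<exists>W. W \<subseteq> A \<and> branch (Suc h) r W"
    proof cases
      case 1 then show ?thesis by (rule step[OF PQR(1,7,10,2,8,11,4) r])
    next
      case 2 then show ?thesis by (rule step[OF PQR(1,7,10,3,9,12,5) r])
    next
      case 3 then show ?thesis by (rule step[OF PQR(2,8,11,3,9,12,6) r])
    qed
  qed
qed

end

section \<open>Attaching and subdividing graphs\<close>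

definition extend :: "'a pair_pre_digraph \<Rightarrow> 'a set \<Rightarrow> 'a rel \<Rightarrow> 'a pair_pre_digraph" where
  "extend G U A = \<lparr>pverts = pverts G \<union> U, parcs = parcs G \<union> A\<rparr>"

lemma extend_simps [simp]:
  "pverts (extend G U A) = pverts G \<union> U" "parcs (extend G U A) = parcs G \<union> A"
  by (simp_all add: extend_def)

lemma pair_pre_digraph_eqI:
  fixes G H :: "'a pair_pre_digraph"
  shows "pverts G = pverts H \<Longrightarrow> parcs G = parcs H \<Longrightarrow> G = H"
  by simp

definition path_arcs :: "'a list \<Rightarrow> 'a rel" where
  "path_arcs vs = set (vwalk_arcs vs) \<union> (set (vwalk_arcs vs))\<inverse>"

lemma path_arcs_Cons: "path_arcs (a # b # vs) = {(a, b), (b, a)} \<union> path_arcs (b # vs)"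
  by (auto simp: path_arcs_def)

lemma path_arcs_subset_verts: "path_arcs vs \<subseteq> set vs \<times> set vs"
  by (induct vs rule: vwalk_arcs.induct) (auto simp: path_arcs_def)

lemma path_arcs_subset:
  assumes "successively (\<lambda>u v. (u, v) \<in> A) vs" "A\<inverse> \<subseteq> A"
  shows "path_arcs vs \<subseteq> A"
  using assms by (induct vs rule: vwalk_arcs.induct) (auto simp: path_arcs_def)

lemma subdivision_pair_pverts_subset: "subdivision_pair T H \<Longrightarrow> pverts T \<subseteq> pverts H"
  by (induct rule: subdivision_pair_induct) auto

lemma subdivision_pair_wf: "subdivision_pair T H \<Longrightarrow> pair_wf_digraph H"
  using bidirected_digraphI_subdivision[of T H]
  by (simp add: pair_bidirected_digraph_def pair_sym_digraph_def)

text \<open>Each arc of \<open>A\<close> has an end outside \<open>H\<close>, so it is never the arc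
  being subdivided. Hence every subdivision step commutes with \<open>extend\<close>.\<close>

lemma subdivision_pair_extend:
  assumes "subdivision_pair T H" "U \<inter> pverts H = {}" "\<And>a b. (a, b) \<in> A \<Longrightarrow> a \<in> U \<or> b \<in> U"
    and "pair_bidirected_digraph (extend T U A)"
  shows "subdivision_pair (extend T U A) (extend H U A)"
  using assms(1,2)
proof (induct rule: subdivision_pair_induct)
  case base
  then show ?case by (intro subdivision_pair_base assms(4))
next
  case (divide e w H)
  obtain u v where e: "e = (u, v)" by (cases e)
  interpret pair_wf_digraph H by (rule subdivision_pair_wf[OF divide(3)])
  have uv: "u \<in> pverts H" "v \<in> pverts H" using divide(1) e in_arcsD1 in_arcsD2 by auto
  have U: "U \<inter> pverts H = {}" "w \<notin> U" using divide(5) by auto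
  have "(u, v) \<notin> A" "(v, u) \<notin> A" using assms(3) uv U(1) by blast+
  then have "subdivide (extend H U A) e w = extend (subdivide H e w) U A"
    unfolding e by (intro pair_pre_digraph_eqI) auto
  moreover have "subdivision_pair (extend T U A) (subdivide (extend H U A) e w)"
    by (rule subdivision_pair_divide) (use divide(1,2) divide(4)[OF U(1)] U(2) in auto)
  ultimately show ?case by simp
qed

text \<open>The vertices of \<open>ws\<close> are inserted one at a time. After \<open>w\<close>,
  the edge from \<open>a\<close> to \<open>w\<close> is final and counted to the fixed part, and the
  edge from \<open>w\<close> to \<open>b\<close> is the one still to be subdivided.\<close>

lemma subdivision_pair_path:
  assumes "subdivision_pair T (extend G {} {(a, b), (b, a)})" "parcs G \<subseteq> pverts G \<times> pverts G"
    and "a \<in> pverts G" "b \<in> pverts G" "a \<noteq> b" "(a, b) \<notin> parcs G" "(b, a) \<notin> parcs G"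
    and "distinct ws" "set ws \<inter> pverts G = {}"
  shows "subdivision_pair T (extend G (set ws) (path_arcs (a # ws @ [b])))"
  using assms
proof (induct ws arbitrary: G a)
  case Nil
  have "path_arcs [a, b] = {(a, b), (b, a)}" by (auto simp: path_arcs_def)
  with Nil(1) show ?case by simp
next
  case (Cons w ws)
  let ?G = "extend G {w} {(a, w), (w, a)}"
  have w: "w \<notin> pverts G" using Cons.prems(9) by simp
  have "subdivide (extend G {} {(a, b), (b, a)}) (a, b) w = extend ?G {} {(w, b), (b, w)}"
    using Cons.prems(6,7) by (intro pair_pre_digraph_eqI) auto
  moreover have "subdivision_pair T (subdivide (extend G {} {(a, b), (b, a)}) (a, b) w)"
    by (rule subdivision_pair_divide[OF _ _ Cons.prems(1)]) (use w in auto)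
  ultimately have "subdivision_pair T (extend ?G {} {(w, b), (b, w)})" by simp
  then have "subdivision_pair T (extend ?G (set ws) (path_arcs (w # ws @ [b])))"
  proof (rule Cons.hyps)
    show "parcs ?G \<subseteq> pverts ?G \<times> pverts ?G" using Cons.prems(2,3) by auto
    show "b \<in> pverts ?G" "w \<in> pverts ?G" using Cons.prems(4) by auto
    show "w \<noteq> b" using w Cons.prems(4) by auto
    show "(w, b) \<notin> parcs ?G" "(b, w) \<notin> parcs ?G" using w Cons.prems(2,3,5) by auto
    show "distinct ws" "set ws \<inter> pverts ?G = {}" using Cons.prems(8,9) by auto
  qed
  moreover have "extend ?G (set ws) (path_arcs (w # ws @ [b])) =
      extend G (set (w # ws)) (path_arcs (a # (w # ws) @ [b]))"
    unfolding append_Cons path_arcs_Cons by (intro pair_pre_digraph_eqI) auto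
  ultimately show ?case by simp
qed

section \<open>Binary trees with levels and rooted subdivisions\<close>

definition level_children :: "'a pair_pre_digraph \<Rightarrow> ('a \<Rightarrow> nat) \<Rightarrow> 'a \<Rightarrow> 'a set" where
  "level_children T f x = {y. (x, y) \<in> parcs T \<and> f y = Suc (f x)}"

definition binary_level_tree :: "nat \<Rightarrow> 'a pair_pre_digraph \<Rightarrow> 'a \<Rightarrow> ('a \<Rightarrow> nat) \<Rightarrow> bool" where
  "binary_level_tree h T r f \<longleftrightarrow> level_tree T r f \<and>
     (\<forall>x \<in> pverts T. card (level_children T f x) = 2 \<or> level_children T f x = {} \<and> f x = h)"

lemma binary_level_tree_complete:
  "binary_level_tree h T r f \<Longrightarrow> complete_binary_tree h T"
  unfolding binary_level_tree_def level_children_def by (blast intro: level_tree.complete_binary_tree)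

lemma binary_level_tree_single:
  "binary_level_tree 0 \<lparr>pverts = {r}, parcs = {}\<rparr> r (\<lambda>_. 0)"
proof -
  have "level_tree \<lparr>pverts = {r}, parcs = {}\<rparr> r (\<lambda>_. 0)"
    by unfold_locales (auto simp: symmetric_def sym_def)
  then show ?thesis by (simp add: binary_level_tree_def level_children_def)
qed

lemma binary_level_tree_join:
  assumes T1: "binary_level_tree h T1 c1 f1" and T2: "binary_level_tree h T2 c2 f2"
    and disj: "pverts T1 \<inter> pverts T2 = {}" "s \<notin> pverts T1" "s \<notin> pverts T2"
  shows "\<exists>f. binary_level_tree (Suc h)
    \<lparr>pverts = insert s (pverts T1 \<union> pverts T2), parcs = parcs T1 \<union> parcs T2 \<union> {(s, c1), (c1, s), (s, c2), (c2, s)}\<rparr> s f"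
    (is "\<exists>f. binary_level_tree _ ?T _ f")
proof -
  interpret T1: level_tree T1 c1 f1 using T1 by (simp add: binary_level_tree_def)
  interpret T2: level_tree T2 c2 f2 using T2 by (simp add: binary_level_tree_def)
  \<comment> \<open>The new root has level 0, and the levels of both trees are raised by
    one.\<close>
  define f where "f x = (if x = s then 0 else if x \<in> pverts T1 then Suc (f1 x) else Suc (f2 x))" for x
  have f1: "f x = Suc (f1 x)" if "x \<in> pverts T1" for x using that disj(2) by (auto simp: f_def)
  have f2: "f x = Suc (f2 x)" if "x \<in> pverts T2" for x using that disj(1,3) by (auto simp: f_def)
  have fs: "f s = 0" by (simp add: f_def)
  have c: "c1 \<in> pverts T1" "c2 \<in> pverts T2" "f1 c1 = 0" "f2 c2 = 0"
    using T1.root T2.root T1.level_root T2.level_root by simp_all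
  have ne: "c1 \<noteq> s" "c2 \<noteq> s" "c1 \<noteq> c2" using c disj by auto
  have arcs1: "x \<in> pverts T1 \<and> y \<in> pverts T1" if "(x, y) \<in> parcs T1" for x y
    using that T1.in_arcsD1 T1.in_arcsD2 by simp
  have arcs2: "x \<in> pverts T2 \<and> y \<in> pverts T2" if "(x, y) \<in> parcs T2" for x y
    using that T2.in_arcsD1 T2.in_arcsD2 by simp
  have in1: "(u, v) \<in> parcs ?T \<longleftrightarrow> (u, v) \<in> parcs T1 \<or> u = s \<and> v = c1" if "v \<in> pverts T1" for u v
    using that arcs1[of u v] arcs2[of u v] disj c by auto
  have in2: "(u, v) \<in> parcs ?T \<longleftrightarrow> (u, v) \<in> parcs T2 \<or> u = s \<and> v = c2" if "v \<in> pverts T2" for u v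
    using that arcs1[of u v] arcs2[of u v] disj c by auto
  have ins: "(u, s) \<in> parcs ?T \<longleftrightarrow> u = c1 \<or> u = c2" for u
    using arcs1[of u s] arcs2[of u s] disj by auto
  have outs: "(s, u) \<in> parcs ?T \<longleftrightarrow> u = c1 \<or> u = c2" for u
    using arcs1[of s u] arcs2[of s u] disj by auto
  have out1: "(v, u) \<in> parcs ?T \<longleftrightarrow> (v, u) \<in> parcs T1 \<or> u = s \<and> v = c1" if "v \<in> pverts T1" for u v
    using that arcs1[of v u] arcs2[of v u] disj c by auto
  have out2: "(v, u) \<in> parcs ?T \<longleftrightarrow> (v, u) \<in> parcs T2 \<or> u = s \<and> v = c2" if "v \<in> pverts T2" for u v
    using that arcs1[of v u] arcs2[of v u] disj c by auto
  have sym: "(v, u) \<in> parcs ?T" if "(u, v) \<in> parcs ?T" for u v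
    using that T1.arcs_symmetric[of u v] T2.arcs_symmetric[of u v] by auto
  have cases: thesis if "v \<in> pverts ?T" "v = s \<Longrightarrow> thesis" "v \<in> pverts T1 \<Longrightarrow> thesis" "v \<in> pverts T2 \<Longrightarrow> thesis" for v thesis
    using that by auto
  have "pair_graph ?T"
  proof
    show "finite (pverts ?T)" "finite (parcs ?T)"
      using T1.pair_finite_verts T2.pair_finite_verts T1.pair_finite_arcs T2.pair_finite_arcs by simp_all
    show "symmetric (with_proj ?T)" unfolding symmetric_def with_proj_simps by (rule symI) (rule sym)
    fix e assume e: "e \<in> parcs ?T"
    obtain u v where uv: "e = (u, v)" by (cases e)
    show "fst e \<in> pverts ?T" "snd e \<in> pverts ?T" "fst e \<noteq> snd e"
      using e uv arcs1[of u v] arcs2[of u v] c ne T1.no_loops'[of u v] T2.no_loops'[of u v] by auto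
  qed
  moreover have "level_tree_axioms ?T s f"
  proof
    show "s \<in> pverts ?T" "f s = 0" using fs by simp_all
  next
    fix u v assume uv: "(u, v) \<in> parcs ?T"
    have "v \<in> pverts ?T" using uv arcs1[of u v] arcs2[of u v] c by auto
    then show "f v = Suc (f u) \<or> f u = Suc (f v)"
    proof (rule cases)
      assume "v = s"
      then show ?thesis using uv ins f1 f2 c fs by auto
    next
      assume v: "v \<in> pverts T1"
      then show ?thesis using uv in1[OF v, of u] f1 arcs1[of u v] T1.level_arc[of u v] c fs by auto
    next
      assume v: "v \<in> pverts T2"
      then show ?thesis using uv in2[OF v, of u] f2 arcs2[of u v] T2.level_arc[of u v] c fs by auto
    qed
  next
    fix v assume v: "v \<in> pverts ?T" "v \<noteq> s"
    from v(1) show "\<exists>u. (u, v) \<in> parcs ?T \<and> f v = Suc (f u)"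
    proof (rule cases)
      assume v1: "v \<in> pverts T1"
      show ?thesis
      proof (cases "v = c1")
        case True
        then show ?thesis using f1 c fs by (intro exI[of _ s]) simp
      next
        case False
        then obtain u where "(u, v) \<in> parcs T1" "f1 v = Suc (f1 u)" using T1.parent[OF v1] by metis
        then show ?thesis using f1 arcs1[of u v] by (intro exI[of _ u]) simp
      qed
    next
      assume v1: "v \<in> pverts T2"
      show ?thesis
      proof (cases "v = c2")
        case True
        then show ?thesis using f2 c fs by (intro exI[of _ s]) simp
      next
        case False
        then obtain u where "(u, v) \<in> parcs T2" "f2 v = Suc (f2 u)" using T2.parent[OF v1] by metis
        then show ?thesis using f2 arcs2[of u v] by (intro exI[of _ u]) simp
      qed
    qed (use v(2) in simp)
  next
    fix u v u' assume uv: "(u, v) \<in> parcs ?T" "(u', v) \<in> parcs ?T" "f v = Suc (f u)" "f v = Suc (f u')"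
    have "v \<in> pverts ?T" using uv(1) arcs1[of u v] arcs2[of u v] c by auto
    then show "u = u'"
    proof (rule cases)
      assume "v = s"
      then show ?thesis using uv(3) fs by simp
    next
      assume v: "v \<in> pverts T1"
      have par: "(w, v) \<in> parcs T1 \<and> f1 v = Suc (f1 w) \<or> w = s \<and> f1 v = 0"
        if "(w, v) \<in> parcs ?T" "f v = Suc (f w)" for w
        using that in1[OF v, of w] f1[OF v] f1[of w] arcs1[of w v] c by auto
      show ?thesis using par[OF uv(1,3)] par[OF uv(2,4)] T1.parent_unique[of u v u'] by auto
    next
      assume v: "v \<in> pverts T2"
      have par: "(w, v) \<in> parcs T2 \<and> f2 v = Suc (f2 w) \<or> w = s \<and> f2 v = 0"
        if "(w, v) \<in> parcs ?T" "f v = Suc (f w)" for w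
        using that in2[OF v, of w] f2[OF v] f2[of w] arcs2[of w v] c by auto
      show ?thesis using par[OF uv(1,3)] par[OF uv(2,4)] T2.parent_unique[of u v u'] by auto
    qed
  qed
  ultimately have "level_tree ?T s f" by (rule level_tree.intro)
  moreover have "card (level_children ?T f x) = 2 \<or> level_children ?T f x = {} \<and> f x = Suc h" if "x \<in> pverts ?T" for x
    using that
  proof (rule cases)
    assume x: "x = s"
    have "level_children ?T f s = {c1, c2}"
      using outs f1[OF c(1)] f2[OF c(2)] c(3,4) fs unfolding level_children_def by (simp only: outs) auto
    then show ?thesis using ne(3) x by simp
  next
    assume x: "x \<in> pverts T1"
    have "level_children ?T f x = level_children T1 f1 x"
    proof -
      have "(x, y) \<in> parcs ?T \<and> f y = Suc (f x) \<longleftrightarrow> (x, y) \<in> parcs T1 \<and> f1 y = Suc (f1 x)" for y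
        using f1[OF x] f1[of y] arcs1[of x y] fs unfolding out1[OF x] by auto
      then show ?thesis unfolding level_children_def by simp
    qed
    then show ?thesis using T1 x f1[OF x] unfolding binary_level_tree_def by simp
  next
    assume x: "x \<in> pverts T2"
    have "level_children ?T f x = level_children T2 f2 x"
    proof -
      have "(x, y) \<in> parcs ?T \<and> f y = Suc (f x) \<longleftrightarrow> (x, y) \<in> parcs T2 \<and> f2 y = Suc (f2 x)" for y
        using f2[OF x] f2[of y] arcs2[of x y] fs unfolding out2[OF x] by auto
      then show ?thesis unfolding level_children_def by simp
    qed
    then show ?thesis using T2 x f2[OF x] unfolding binary_level_tree_def by simp
  qed
  ultimately show ?thesis unfolding binary_level_tree_def by blast
qed

text \<open>
  The list \<open>vs\<close> is the stem, which leads from \<open>r\<close> to the root \<open>c\<close> of the subdivided tree \<open>H\<close>.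
\<close>

definition rooted_subdivision :: "'a pair_pre_digraph \<Rightarrow> nat \<Rightarrow> 'a \<Rightarrow> 'a set \<Rightarrow> bool" where
  "rooted_subdivision G h r W \<longleftrightarrow> (\<exists>T H c f vs. binary_level_tree h T c f \<and> subdivision_pair T H \<and>
     pverts H \<subseteq> W \<and> parcs H \<subseteq> parcs G \<and> vs \<noteq> [] \<and> hd vs = r \<and> last vs = c \<and> distinct vs \<and> set vs \<subseteq> W \<and>
     set vs \<inter> pverts H = {c} \<and> successively (\<lambda>u v. (u, v) \<in> parcs G) vs)"

lemma pair_graph_bidirected: "pair_graph G \<Longrightarrow> pair_bidirected_digraph G"
proof -
  assume "pair_graph G"
  then interpret pair_graph G .
  show ?thesis by unfold_locales
qed

lemma rooted_subdivision_leaf: "rooted_subdivision G 0 r {r}"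
proof -
  let ?T = "\<lparr>pverts = {r}, parcs = {}\<rparr>"
  have T: "binary_level_tree 0 ?T r (\<lambda>_. 0)" by (rule binary_level_tree_single)
  then have "pair_graph ?T" by (simp add: binary_level_tree_def level_tree_def)
  then have "subdivision_pair ?T ?T" by (intro subdivision_pair_base pair_graph_bidirected)
  with T show ?thesis unfolding rooted_subdivision_def
    by (intro exI[of _ ?T] exI[of _ r] exI[of _ "\<lambda>_. 0"] exI[of _ "[r]"]) simp
qed

lemma rooted_subdivision_stem:
  assumes "rooted_subdivision G h r W" "(s, r) \<in> parcs G" "s \<notin> W"
  shows "rooted_subdivision G h s (insert s W)"
proof -
  obtain T H c f vs where *: "binary_level_tree h T c f" "subdivision_pair T H" "pverts H \<subseteq> W" "parcs H \<subseteq> parcs G"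
      "vs \<noteq> []" "hd vs = r" "last vs = c" "distinct vs" "set vs \<subseteq> W" "set vs \<inter> pverts H = {c}"
      "successively (\<lambda>u v. (u, v) \<in> parcs G) vs"
    using assms(1) unfolding rooted_subdivision_def by (elim exE conjE) (rule that)
  have "s \<notin> set vs" "s \<notin> pverts H" using * assms(3) by blast+
  moreover have "pverts H \<subseteq> insert s W" "set (s # vs) \<subseteq> insert s W" using *(3,9) by auto
  ultimately show ?thesis
    unfolding rooted_subdivision_def using * assms(2)
    by (intro exI[of _ T] exI[of _ H] exI[of _ c] exI[of _ f] exI[of _ "s # vs"])
      (simp add: successively_Cons)
qed

text \<open>In the tree \<open>T\<close> obtained by joining \<open>T1\<close> and \<open>T2\<close>
  at \<open>s\<close>, first \<open>T1\<close> is replaced by \<open>H1\<close> (giving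
  \<open>M\<close>), then \<open>T2\<close> by \<open>H2\<close> (giving \<open>N\<close>). Finally
  the edges from \<open>s\<close> to \<open>c1\<close> and \<open>c2\<close> are subdivided along
  the two stems, which makes all arcs arcs of \<open>G\<close>.\<close>

lemma rooted_subdivision_fork:
  assumes G: "pair_graph G"
    and 1: "rooted_subdivision G h r1 W1" and 2: "rooted_subdivision G h r2 W2"
    and W: "W1 \<inter> W2 = {}" "s \<notin> W1" "s \<notin> W2" and sr: "(s, r1) \<in> parcs G" "(s, r2) \<in> parcs G"
  shows "rooted_subdivision G (Suc h) s (insert s (W1 \<union> W2))"
proof -
  obtain T1 H1 c1 f1 vs1 where *: "binary_level_tree h T1 c1 f1" "subdivision_pair T1 H1" "pverts H1 \<subseteq> W1" "parcs H1 \<subseteq> parcs G"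
      "vs1 \<noteq> []" "hd vs1 = r1" "last vs1 = c1" "distinct vs1" "set vs1 \<subseteq> W1" "set vs1 \<inter> pverts H1 = {c1}"
      "successively (\<lambda>u v. (u, v) \<in> parcs G) vs1"
    using 1 unfolding rooted_subdivision_def by (elim exE conjE) (rule that)
  obtain T2 H2 c2 f2 vs2 where **: "binary_level_tree h T2 c2 f2" "subdivision_pair T2 H2" "pverts H2 \<subseteq> W2" "parcs H2 \<subseteq> parcs G"
      "vs2 \<noteq> []" "hd vs2 = r2" "last vs2 = c2" "distinct vs2" "set vs2 \<subseteq> W2" "set vs2 \<inter> pverts H2 = {c2}"
      "successively (\<lambda>u v. (u, v) \<in> parcs G) vs2"
    using 2 unfolding rooted_subdivision_def by (elim exE conjE) (rule that)
  have TH: "pverts T1 \<subseteq> pverts H1" "pverts T2 \<subseteq> pverts H2"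
    using subdivision_pair_pverts_subset *(2) **(2) by blast+
  have sep: "pverts H1 \<inter> pverts H2 = {}" "s \<notin> pverts H1" "s \<notin> pverts H2" using *(3) **(3) W by blast+
  have c: "c1 \<in> pverts H1" "c2 \<in> pverts H2" using *(10) **(10) by blast+
  have wf1: "pair_wf_digraph H1" "pair_wf_digraph T1" and wf2: "pair_wf_digraph H2" "pair_wf_digraph T2"
    using subdivision_pair_wf[OF *(2)] subdivision_pair_wf[OF **(2)]
      *(1) **(1) unfolding binary_level_tree_def level_tree_def pair_graph_def pair_digraph_def pair_fin_digraph_def
    by simp_all
  have arcs: "parcs X \<subseteq> pverts X \<times> pverts X" if "pair_wf_digraph X" for X :: "'a pair_pre_digraph"
    using pair_wf_digraph.in_arcsD1[OF that] pair_wf_digraph.in_arcsD2[OF that] by auto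
  note arcs = arcs[OF wf1(1)] arcs[OF wf1(2)] arcs[OF wf2(1)] arcs[OF wf2(2)]
  define Es where "Es = {(s, c1), (c1, s), (s, c2), (c2, s)}"
  define T where "T = \<lparr>pverts = insert s (pverts T1 \<union> pverts T2), parcs = parcs T1 \<union> parcs T2 \<union> Es\<rparr>"
  obtain f where f: "binary_level_tree (Suc h) T s f"
    using binary_level_tree_join[OF *(1) **(1), of s] TH sep unfolding T_def Es_def by blast
  then have gT: "pair_graph T" by (simp add: binary_level_tree_def level_tree_def)
  define M where "M = \<lparr>pverts = insert s (pverts H1 \<union> pverts T2), parcs = parcs H1 \<union> parcs T2 \<union> Es\<rparr>"
  have Teq: "T = extend T1 (insert s (pverts T2)) (parcs T2 \<union> Es)" and "M = extend H1 (insert s (pverts T2)) (parcs T2 \<union> Es)"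
    unfolding T_def M_def by (intro pair_pre_digraph_eqI; auto)+
  moreover have "subdivision_pair (extend T1 (insert s (pverts T2)) (parcs T2 \<union> Es))
      (extend H1 (insert s (pverts T2)) (parcs T2 \<union> Es))"
  proof (rule subdivision_pair_extend[OF *(2)])
    show "insert s (pverts T2) \<inter> pverts H1 = {}" using sep TH(2) by blast
    show "a \<in> insert s (pverts T2) \<or> b \<in> insert s (pverts T2)" if "(a, b) \<in> parcs T2 \<union> Es" for a b
      using that arcs(4) unfolding Es_def by auto
    show "pair_bidirected_digraph (extend T1 (insert s (pverts T2)) (parcs T2 \<union> Es))"
      unfolding Teq[symmetric] by (rule pair_graph_bidirected[OF gT])
  qed
  ultimately have TM: "subdivision_pair T M" unfolding Teq by simp
  define N where "N = \<lparr>pverts = insert s (pverts H1 \<union> pverts H2), parcs = parcs H1 \<union> parcs H2 \<union> Es\<rparr>"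
  have Meq: "M = extend T2 (insert s (pverts H1)) (parcs H1 \<union> Es)" and "N = extend H2 (insert s (pverts H1)) (parcs H1 \<union> Es)"
    unfolding N_def M_def by (intro pair_pre_digraph_eqI; auto)+
  moreover have "subdivision_pair (extend T2 (insert s (pverts H1)) (parcs H1 \<union> Es))
      (extend H2 (insert s (pverts H1)) (parcs H1 \<union> Es))"
  proof (rule subdivision_pair_extend[OF **(2)])
    show "insert s (pverts H1) \<inter> pverts H2 = {}" using sep by blast
    show "a \<in> insert s (pverts H1) \<or> b \<in> insert s (pverts H1)" if "(a, b) \<in> parcs H1 \<union> Es" for a b
      using that arcs(1) unfolding Es_def by auto
    show "pair_bidirected_digraph (extend T2 (insert s (pverts H1)) (parcs H1 \<union> Es))"
      unfolding Meq[symmetric] by (rule bidirected_digraphI_subdivision[OF TM])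
  qed
  ultimately have "subdivision_pair M N" unfolding Meq by simp
  with TM have TN: "subdivision_pair T N" by (rule subdivision_trans)
  define ws1 where "ws1 = butlast vs1"
  define ws2 where "ws2 = butlast vs2"
  have vs: "vs1 = ws1 @ [c1]" "vs2 = ws2 @ [c2]" unfolding ws1_def ws2_def using *(5,7) **(5,7) by auto
  have ws: "set ws1 \<inter> pverts H1 = {}" "set ws2 \<inter> pverts H2 = {}" "distinct ws1" "distinct ws2"
    "set ws1 \<subseteq> W1" "set ws2 \<subseteq> W2"
    using *(8-10) **(8-10) unfolding vs by auto
  have c_in: "c1 \<in> W1" "c2 \<in> W2" using c *(3) **(3) by blast+
  have ne: "s \<noteq> c1" "s \<noteq> c2" "c1 \<noteq> c2" using c_in W by auto
  define P where "P = path_arcs (s # vs1)"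
  define Q where "Q = path_arcs (s # vs2)"
  have P: "P \<subseteq> insert s W1 \<times> insert s W1"
    using path_arcs_subset_verts[of "s # vs1"] *(9) unfolding P_def by auto
  \<comment> \<open>\<open>X\<close> is \<open>N\<close> without the edge from \<open>s\<close> to
    \<open>c1\<close>, which the path along \<open>vs1\<close> is about to replace.\<close>
  define X where "X = \<lparr>pverts = insert s (pverts H1 \<union> pverts H2), parcs = parcs H1 \<union> parcs H2 \<union> {(s, c2), (c2, s)}\<rparr>"
  have "N = extend X {} {(s, c1), (c1, s)}" unfolding N_def X_def Es_def by (intro pair_pre_digraph_eqI) auto
  with TN have "subdivision_pair T (extend X {} {(s, c1), (c1, s)})" by simp
  then have TX: "subdivision_pair T (extend X (set ws1) (path_arcs (s # ws1 @ [c1])))"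
  proof (rule subdivision_pair_path[OF _ _ _ _ ne(1)])
    show "parcs X \<subseteq> pverts X \<times> pverts X" using arcs c unfolding X_def by auto
    show "s \<in> pverts X" "c1 \<in> pverts X" using c unfolding X_def by auto
    show "(s, c1) \<notin> parcs X" "(c1, s) \<notin> parcs X" using arcs sep ne unfolding X_def by auto
    show "distinct ws1" by (rule ws)
    show "set ws1 \<inter> pverts X = {}" using ws(1,5) W **(3) unfolding X_def by auto
  qed
  \<comment> \<open>\<open>Y\<close> contains the first path but not yet any connection from
    \<open>s\<close> to \<open>c2\<close>.\<close>
  define Y where "Y = \<lparr>pverts = insert s (pverts H1 \<union> pverts H2 \<union> set ws1), parcs = parcs H1 \<union> parcs H2 \<union> P\<rparr>"
  have "extend X (set ws1) (path_arcs (s # ws1 @ [c1])) = extend Y {} {(s, c2), (c2, s)}"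
    unfolding X_def Y_def P_def vs by (intro pair_pre_digraph_eqI) auto
  with TX have "subdivision_pair T (extend Y {} {(s, c2), (c2, s)})" by simp
  then have TY: "subdivision_pair T (extend Y (set ws2) (path_arcs (s # ws2 @ [c2])))"
  proof (rule subdivision_pair_path[OF _ _ _ _ ne(2)])
    have "P \<subseteq> set (s # vs1) \<times> set (s # vs1)" unfolding P_def by (rule path_arcs_subset_verts)
    then show "parcs Y \<subseteq> pverts Y \<times> pverts Y" using arcs c unfolding Y_def vs by auto
    show "s \<in> pverts Y" "c2 \<in> pverts Y" using c unfolding Y_def by auto
    show "(s, c2) \<notin> parcs Y" "(c2, s) \<notin> parcs Y"
      using arcs sep ne P c_in W unfolding Y_def by auto
    show "distinct ws2" by (rule ws)
    show "set ws2 \<inter> pverts Y = {}" using ws W *(3) unfolding Y_def by auto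
  qed
  let ?H = "extend Y (set ws2) (path_arcs (s # ws2 @ [c2]))"
  have symG: "(parcs G)\<inverse> \<subseteq> parcs G"
    using G pair_sym_digraph.arcs_symmetric by (auto simp: pair_graph_def pair_pseudo_graph_def)
  have "P \<subseteq> parcs G" unfolding P_def
    by (rule path_arcs_subset[OF _ symG]) (use *(5,6,11) sr in \<open>simp add: successively_Cons\<close>)
  moreover have "path_arcs (s # ws2 @ [c2]) \<subseteq> parcs G" unfolding vs(2)[symmetric]
    by (rule path_arcs_subset[OF _ symG]) (use **(5,6,11) sr in \<open>simp add: successively_Cons\<close>)
  ultimately have "parcs ?H \<subseteq> parcs G" using *(4) **(4) unfolding Y_def by auto
  moreover have "pverts ?H \<subseteq> insert s (W1 \<union> W2)" using *(3) **(3) ws(5,6) unfolding Y_def by auto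
  moreover have "s \<in> pverts ?H" unfolding Y_def by simp
  ultimately show ?thesis
    unfolding rooted_subdivision_def using f TY
    by (intro exI[of _ T] exI[of _ ?H] exI[of _ s] exI[of _ f] exI[of _ "[s]"]) simp
qed

lemma branch_rooted_subdivision:
  assumes G: "pair_graph G" and "symmetric_relation.branch (\<lambda>u v. (u, v) \<in> parcs G) h r W"
  shows "rooted_subdivision G h r W"
proof -
  interpret symmetric_relation "\<lambda>u v. (u, v) \<in> parcs G" by (rule symmetric_relation_parcs[OF G])
  show ?thesis using assms(2)
  proof (induct rule: branch.induct)
    case (leaf r)
    show ?case by (rule rooted_subdivision_leaf)
  next
    case (stem h r W s)
    then show ?case by (intro rooted_subdivision_stem[where r = r]) auto
  next
    case (fork h r W r' W' s)
    then show ?case by (intro rooted_subdivision_fork[OF G, where ?r1.0 = r and ?r2.0 = r']) auto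
  qed
qed

lemma rooted_subdivision_contains:
  assumes G: "pair_graph G" and "rooted_subdivision G h r W" "W \<subseteq> pverts G"
  shows "contains_subdivided_binary_tree h G"
proof -
  obtain T H c f where *: "binary_level_tree h T c f" "subdivision_pair T H" "pverts H \<subseteq> W" "parcs H \<subseteq> parcs G"
    using assms(2) unfolding rooted_subdivision_def by blast
  have "subgraph (with_proj H) (with_proj G)"
    unfolding subgraph_def using *(3,4) assms(3) subdivision_pair_wf[OF *(2)] G
    by (auto simp: wf_digraph_wp_iff pair_graph_def pair_digraph_def pair_fin_digraph_def)
  then show ?thesis
    unfolding contains_subdivided_binary_tree_def using *(2) binary_level_tree_complete[OF *(1)] by blast
qed

theorem theorem1:
  fixes G :: "'a pair_pre_digraph" and t h :: nat
  assumes "pair_graph G"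
    and "t \<ge> 1"
    and "treewidth G = int t - 1"
  shows "pathwidth G \<le> int (t * h + 1) \<or> contains_subdivided_binary_tree (h + 1) G"
proof -
  obtain T :: "nat pair_pre_digraph" and B where T: "tree_decomposition G T B" "decomposition_width T B = int t - 1"
    using treewidth_attained[OF assms(1)] assms(3) by metis
  interpret tree_bags "\<lambda>u v. (u, v) \<in> parcs G" "\<lambda>x y. (x, y) \<in> parcs T" "pverts T" B "pverts G" t
    by (rule tree_decomposition_tree_bags[OF assms(1) T])
  show ?thesis
  \<comment> \<open>Heavy sets are connected, so the components of \<open>G\<close> are treated
    separately.\<close>
  proof (cases "\<exists>A \<in> comps (pverts G). heavy (Suc h) A")
    case True
    then obtain A where A: "A \<in> comps (pverts G)" "heavy (Suc h) A" by blast
    have AV: "A \<subseteq> pverts G" by (rule comps_subset[OF A(1)])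
    have "full (Suc h) A" by (rule heavy_full[OF A(2) finite_subset[OF AV finite_V]])
    moreover obtain r where "r \<in> A" using conn_nonempty[OF comps_conn[OF A(1)]] by blast
    ultimately obtain W where W: "W \<subseteq> A" "branch (Suc h) r W" unfolding full_def by metis
    have "contains_subdivided_binary_tree (Suc h) G"
      by (rule rooted_subdivision_contains[OF assms(1) branch_rooted_subdivision[OF assms(1) W(2)]])
        (use W(1) AV in blast)
    then show ?thesis by simp
  next
    case False
    have "\<exists>L. path_bags (t * h + 2) (\<Union>(comps (pverts G))) L"
    proof (rule path_bags_Union_comps[OF _ order_refl])
      show "finite (comps (pverts G))" using finite_V by (simp add: comps_def)
      show "\<exists>L. path_bags (t * h + 2) D L" if "D \<in> comps (pverts G)" for D
        using path_bags_of_not_heavy[OF comps_conn[OF that] comps_subset[OF that]] False that by metis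
    qed
    then obtain L where L: "path_bags (t * h + 2) (pverts G) L" unfolding Union_comps by metis
    have "\<exists>L. path_bags (t * h + 2) (pverts G) L \<and> L \<noteq> []"
    proof (cases "L = []")
      case True
      \<comment> \<open>A path has at least one node, so the empty list is replaced by a single
        empty bag.\<close>
      then have "path_bags (t * h + 2) (pverts G) [{}]" using L by (simp add: path_bags_def)
      then show ?thesis by (intro exI[of _ "[{}]"]) simp
    qed (use L in blast)
    then obtain L where L: "path_bags (t * h + 2) (pverts G) L" "L \<noteq> []" by metis
    \<comment> \<open>Bags of size at most \<open>t * h + 2\<close> give width at most
      \<open>t * h + 1\<close>.\<close>
    have "pathwidth G \<le> int (t * h + 2) - 1"
      using pathwidth_le[OF path_bags_imp_path_decomposition(1)[OF assms(1) L]]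
        path_bags_imp_path_decomposition(2)[OF assms(1) L] by linarith
    then show ?thesis by simp
  qed
qed

end
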